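(* Let $N\ge 1$ and $p>1$. There exist constants $\gamma_1=\gamma_1(N,p,\alpha)>0$, $\alpha\in(0,1)$, depending only on $N,p,\alpha$ and satisfying $\limsup_{\alpha\to1-0}\gamma_1(N,p,\alpha)\in(0,\infty)$, such that the following holds. Let $\alpha\in(0,1)$, $T\in(0,\infty)$, and let $\mu$ be a nonnegative Radon measure on $\mathbf{R}^N$. If the problem $$(\mathrm{P})_\alpha:\qquad {}^{C}\partial_t^\alpha u-\Delta u=u^p\quad (t>0,\ x\in\mathbf{R}^N),\qquad u(0)=\mu\ \text{ in }\mathbf{R}^N,$$ possesses a solution in $[0,T)\times\mathbf{R}^N$, then $$\sup_{z\in\mathbf{R}^N}\mu(B(z;\sigma))\le\gamma_1\,\sigma^{N-\frac{2}{p-1}}\qquad\text{for all }\sigma\in(0,T^{\alpha/2}).$$ In addition, in the case $p=p_F:=1+2/N$, there exist constants $\gamma_1'=\gamma_1'(N,\alpha)>0$, depending only on $N,\alpha$ and satisfying $\limsup_{\alpha\to1-0}\gamma_1'(N,\alpha)\in(0,\infty)$, such that for all $\alpha\in(0,1)$, $T\in(0,\infty)$ and nonnegative Radon measures $\mu$ on $\mathbf{R}^N$ for which $(\mathrm{P})_\alpha$ possesses a solution in $[0,T)\times\mathbf{R}^N$, $$\sup_{z\in\mathbf{R}^N}\mu(B(z;\sigma))\le\gamma_1'\left(\int_{\sigma^{2/\alpha}/(16T)}^{1/4}t^{-\alpha}\,dt\right)^{-\frac N2}\qquad\text{for all }\sigma\in(0,T^{\alpha/2}).$$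
   Context: $B(z;r):=\{y\in\mathbf{R}^N;\ |z-y|<r\}$. For $t>0$, $x\in\mathbf{R}^N$, $G(t,x):=(4\pi t)^{-N/2}\exp(-|x|^2/(4t))$, and for a Radon measure $\mu$ on $\mathbf{R}^N$, $e^{t\Delta}\mu(x):=\int_{\mathbf{R}^N}G(t,x-y)\,d\mu(y)$. A locally integrable function $\phi$ is identified with the Radon measure $\phi\,dx$. For $\alpha\in(0,1)$, $h_\alpha>0$ denotes the probability density function on $(0,\infty)$ characterized by $$\int_0^\infty h_\alpha(\theta)e^{z\theta}\,d\theta=E_{\alpha,1}(z),\qquad z\in\mathbf{C},\qquad\text{where } E_{\alpha,\beta}(z):=\sum_{k=0}^\infty\frac{z^k}{\Gamma(\alpha k+\beta)}$$ is the Mittag--Leffler function. It also satisfies $\int_0^\infty\alpha\theta h_\alpha(\theta)e^{z\theta}\,d\theta=E_{\alpha,\alpha}(z)$ for $z\in\mathbf{C}$ and $\int_0^\infty\theta^\delta h_\alpha(\theta)\,d\theta=\Gamma(1+\delta)/\Gamma(1+\alpha\delta)<\infty$ for $\delta>-1$. Set, for $t>0$, $$P_\alpha(t)\mu:=\int_0^\infty h_\alpha(\theta)\,e^{t^\alpha\theta\Delta}\mu\,d\theta,\qquad S_\alpha(t)\mu:=\int_0^\infty\theta h_\alpha(\theta)\,e^{t^\alpha\theta\Delta}\mu\,d\theta.$$ Here ${}^{C}\partial_t^\alpha$ is the Caputo derivative of order $\alpha$, $({}^{C}\partial_t^\alpha f)(t)=\frac{1}{\Gamma(1-\alpha)}\frac{d}{dt}\int_0^t\frac{f(s)-f(0)}{(t-s)^\alpha}\,ds$,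 but solutions are understood in the following integral sense. Definition of solution: for $T\in(0,\infty]$, a nonnegative measurable function $u$ on $(0,T)\times\mathbf{R}^N$ is a solution of $(\mathrm{P})_\alpha$ in $[0,T)\times\mathbf{R}^N$ if $$\infty>u(t,x)=[P_\alpha(t)\mu](x)+\alpha\int_0^t(t-s)^{\alpha-1}[S_\alpha(t-s)u(s)^p](x)\,ds$$ for almost all $t\in(0,T)$ and $x\in\mathbf{R}^N$. *)

theory Defs
  imports "HOL-Analysis.Analysis"
begin

definition mittag_leffler :: "real \<Rightarrow> real \<Rightarrow> complex \<Rightarrow> complex" where
  "mittag_leffler \<alpha> \<beta> z = (\<Sum>k. z ^ k / of_real (Gamma (\<alpha> * real k + \<beta>)))"

text \<open>
  The defining properties of the density \<open>h\<^sub>\<alpha>\<close>. They determine it on \<open>(0,\<infinity>)\<close> up to a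
  Lebesgue null set; the values outside \<open>(0,\<infinity>)\<close> are irrelevant.
\<close>

definition is_h_density :: "real \<Rightarrow> (real \<Rightarrow> real) \<Rightarrow> bool" where
  "is_h_density \<alpha> h \<longleftrightarrow>
     set_borel_measurable lborel {0<..} h \<and>
     (\<forall>\<theta>>0. 0 < h \<theta>) \<and>
     (\<integral>\<^sup>+\<theta>\<in>{0<..}. ennreal (h \<theta>) \<partial>lborel) = 1 \<and>
     (\<forall>z::complex.
        set_integrable lborel {0<..} (\<lambda>\<theta>. of_real (h \<theta>) * exp (z * of_real \<theta>)) \<and>
        (LINT \<theta>:{0<..}|lborel. of_real (h \<theta>) * exp (z * of_real \<theta>)) = mittag_leffler \<alpha> 1 z)"

text \<open>
  On a Euclidean space every Borel measure that is finite on compact sets is regular, so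
  regularity is not listed separately.
\<close>

definition radon_measure :: "'a::euclidean_space measure \<Rightarrow> bool" where
  "radon_measure \<mu> \<longleftrightarrow> sets \<mu> = sets borel \<and> (\<forall>K. compact K \<longrightarrow> emeasure \<mu> K < \<infinity>)"

definition heat_kernel :: "real \<Rightarrow> 'a::euclidean_space \<Rightarrow> real" where
  "heat_kernel t x = (4 * pi * t) powr (- (real DIM('a) / 2)) * exp (- (norm x)\<^sup>2 / (4 * t))"

definition heat :: "real \<Rightarrow> 'a::euclidean_space measure \<Rightarrow> 'a \<Rightarrow> ennreal" where
  "heat t \<mu> x = (\<integral>\<^sup>+y. ennreal (heat_kernel t (x - y)) \<partial>\<mu>)"

text \<open>
  The argument \<open>h\<close> of the following operators is the density \<open>h\<^sub>\<alpha>\<close>.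
\<close>

definition P_op ::
    "real \<Rightarrow> (real \<Rightarrow> real) \<Rightarrow> real \<Rightarrow> 'a::euclidean_space measure \<Rightarrow> 'a \<Rightarrow> ennreal" where
  "P_op \<alpha> h t \<mu> x =
     (\<integral>\<^sup>+\<theta>\<in>{0<..}. ennreal (h \<theta>) * heat (t powr \<alpha> * \<theta>) \<mu> x \<partial>lborel)"

definition S_op ::
    "real \<Rightarrow> (real \<Rightarrow> real) \<Rightarrow> real \<Rightarrow> 'a::euclidean_space measure \<Rightarrow> 'a \<Rightarrow> ennreal" where
  "S_op \<alpha> h t \<mu> x =
     (\<integral>\<^sup>+\<theta>\<in>{0<..}. ennreal (\<theta> * h \<theta>) * heat (t powr \<alpha> * \<theta>) \<mu> x \<partial>lborel)"

text \<open>
  The power \<open>v\<^sup>p\<close> of \<open>v \<in> [0,\<infinity>]\<close>, intended for \<open>p > 0\<close>.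
\<close>

definition ennreal_powr :: "ennreal \<Rightarrow> real \<Rightarrow> ennreal" where
  "ennreal_powr v p = (if v = \<infinity> then \<infinity> else ennreal (enn2real v powr p))"

text \<open>
  Solutions on \<open>[0,T)\<close> with \<open>0 < T \<le> \<infinity>\<close>. ``Measurable'' means Lebesgue measurable. The function
  \<open>u(s)\<^sup>p\<close> enters \<open>S_op\<close> as the measure \<open>u(s)\<^sup>p dx\<close>, and ``almost all'' refers to the Lebesgue
  measure on space-time.
\<close>

definition is_solution ::
    "real \<Rightarrow> (real \<Rightarrow> real) \<Rightarrow> real \<Rightarrow> 'a::euclidean_space measure \<Rightarrow> ereal \<Rightarrow>
     (real \<Rightarrow> 'a \<Rightarrow> ennreal) \<Rightarrow> bool" where
  "is_solution \<alpha> h p \<mu> T u \<longleftrightarrow>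
     (\<lambda>(t, x). u t x) \<in> borel_measurable (lebesgue_on ({t. 0 < t \<and> ereal t < T} \<times> UNIV)) \<and>
     (AE (t, x) in lebesgue. 0 < t \<and> ereal t < T \<longrightarrow>
        u t x < \<infinity> \<and>
        u t x = P_op \<alpha> h t \<mu> x +
          ennreal \<alpha> * (\<integral>\<^sup>+s\<in>{0<..<t}. ennreal ((t - s) powr (\<alpha> - 1)) *
             S_op \<alpha> h (t - s) (density lebesgue (\<lambda>y. ennreal_powr (u s y) p)) x \<partial>lborel))"

end

theory Submission
  imports Defs "HOL-Probability.Distributions"
begin

text \<open>
  Test the integral equation at time \<open>t\<close> against the Gaussian \<open>G(t\<^sup>\<alpha>, x - z)\<close> and set
  \<open>w(t) = t\<^bsup>\<alpha>N/2\<^esup> \<integral> G(t\<^sup>\<alpha>, x - z) u(t, x) dx\<close>. By the semigroup property, the heat kernels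
  in the definition of \<open>P\<^sub>\<alpha>\<close> and \<open>S\<^sub>\<alpha>\<close> turn into Gaussians \<open>G(\<tau>, y - z)\<close> with \<open>\<tau>\<close> between
  \<open>s\<^sup>\<alpha>\<close> and \<open>(1 + A) t\<^sup>\<alpha>\<close> as long as \<open>\<theta> \<le> A\<close>, so Jensen's inequality yields, for \<open>\<sigma>\<^sup>2 \<le> 16 t\<^sub>0\<^sup>\<alpha>\<close>
  and \<open>t\<^sub>0 < t < t\<^sub>1\<close>,
  \<open>w(t) \<ge> c \<mu>(B(z;\<sigma>)) + c t\<^sub>1\<^bsup>\<alpha>-1\<^esup> \<integral> s\<^bsup>-\<alpha>N(p-1)/2\<^esup> w(s)\<^sup>p ds\<close>, the integral being over \<open>(t\<^sub>0, t)\<close>.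
  Such a \<open>w\<close> becomes infinite before \<open>t\<^sub>1\<close> unless
  \<open>\<mu>(B(z;\<sigma>))\<^bsup>p-1\<^esup> t\<^sub>1\<^bsup>\<alpha>-1\<^esup> \<integral> s\<^bsup>-\<alpha>N(p-1)/2\<^esup> ds\<close>, now over \<open>(t\<^sub>0, t\<^sub>1)\<close>, is bounded. With
  \<open>t\<^sub>0 = \<sigma>\<^bsup>2/\<alpha>\<^esup> / 16\<close>, the choice \<open>t\<^sub>1 = \<sigma>\<^bsup>2/\<alpha>\<^esup>\<close> gives the first estimate and \<open>t\<^sub>1 = T\<close> the critical one.
  The constants \<open>A\<close> and \<open>c\<close> only depend on how much mass \<open>h\<^sub>\<alpha>\<close> and \<open>\<theta> h\<^sub>\<alpha>\<close> have on \<open>(0, A]\<close>,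
  which is controlled, uniformly for \<open>\<alpha>\<close> away from \<open>0\<close>, by \<open>E\<^bsub>\<alpha>,1\<^esub>(1)\<close> and \<open>E\<^bsub>\<alpha>,1\<^esub>(2)\<close>.
\<close>

subsection \<open>The heat kernel and Jensen's inequality\<close>

lemma heat_kernel_nonneg: "0 \<le> heat_kernel t x"
  by (simp add: heat_kernel_def)

lemma borel_measurable_heat_kernel [measurable (raw)]:
  assumes [measurable]: "f \<in> borel_measurable M" "g \<in> borel_measurable M"
  shows "(\<lambda>w. heat_kernel (f w) (g w)) \<in> borel_measurable M"
  unfolding heat_kernel_def by measurable

text \<open>The kernel factors over the coordinates into one-dimensional normal densities, so
  Tonelli reduces the claim to the normalisation of each factor.\<close>

lemma nn_integral_heat_kernel:
  fixes m :: "'a::euclidean_space"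
  assumes t: "0 < t"
  shows "(\<integral>\<^sup>+x. ennreal (heat_kernel t (x - m)) \<partial>lborel) = 1"
proof -
  \<comment> \<open>Variance 2t turns the normal exponent -w^2 / (2 s^2) into -w^2 / (4t).\<close>
  define s where "s = sqrt (2 * t)"
  have s: "s > 0" "s\<^sup>2 = 2 * t" using t by (auto simp: s_def)
  have norm2: "(norm w)\<^sup>2 = (\<Sum>b\<in>Basis. (w \<bullet> b)\<^sup>2)" for w :: 'a
    by (subst power2_norm_eq_inner, subst euclidean_inner) (simp add: power2_eq_square)
  have "heat_kernel t (x - m) = (\<Prod>b\<in>Basis. normal_density (m \<bullet> b) s (x \<bullet> b))" for x :: 'a
  proof -
    have "(\<Prod>b\<in>Basis. normal_density (m \<bullet> b) s (x \<bullet> b)) =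
        (1 / sqrt (4 * pi * t)) ^ DIM('a) * exp (\<Sum>b\<in>Basis. - ((x - m) \<bullet> b)\<^sup>2 / (4 * t))"
      using s by (simp add: normal_density_def prod.distrib exp_sum inner_diff_left prod_dividef power_divide
          algebra_simps)
    also have "(\<Sum>b\<in>Basis. - ((x - m) \<bullet> b)\<^sup>2 / (4 * t)) = - (norm (x - m))\<^sup>2 / (4 * t)"
      unfolding norm2 by (simp add: sum_divide_distrib sum_negf)
    also have "(1 / sqrt (4 * pi * t)) ^ DIM('a) = (4 * pi * t) powr (- (real DIM('a) / 2))"
      using t by (simp add: powr_realpow [symmetric] powr_half_sqrt [symmetric] powr_powr
          powr_minus powr_divide field_simps)
    finally show ?thesis by (simp add: heat_kernel_def)
  qed
  then have "(\<integral>\<^sup>+x. ennreal (heat_kernel t (x - m)) \<partial>lborel) =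
      (\<integral>\<^sup>+x. (\<Prod>b\<in>Basis. ennreal (normal_density (m \<bullet> b) s (x \<bullet> b))) \<partial>lborel)"
    by (simp add: prod_ennreal)
  also have "\<dots> = (\<Prod>b\<in>Basis. \<integral>\<^sup>+x. ennreal (normal_density (m \<bullet> b) s x) \<partial>lborel)"
    by (rule nn_integral_lborel_prod) auto
  also have "\<dots> = 1"
  proof (rule prod.neutral, rule ballI)
    fix b :: 'a
    interpret prob_space "density lborel (normal_density (m \<bullet> b) s)"
      using s by (intro prob_space_normal_density)
    show "(\<integral>\<^sup>+x. ennreal (normal_density (m \<bullet> b) s x) \<partial>lborel) = 1"
      using emeasure_space_1 by (simp add: emeasure_density)
  qed
  finally show ?thesis .
qed

text \<open>Completing the square: as a function of x, the product of the two Gaussians is a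
  Gaussian of time \<open>c\<close> centred at the weighted mean \<open>m\<close>, times a factor
  that does not depend on x. Normalisation removes the former.\<close>

lemma heat_kernel_semigroup:
  fixes y z :: "'a::euclidean_space"
  assumes a: "0 < a" and b: "0 < b"
  shows "(\<integral>\<^sup>+x. ennreal (heat_kernel a (x - z)) * ennreal (heat_kernel b (x - y)) \<partial>lborel) =
    ennreal (heat_kernel (a + b) (y - z))"
proof -
  define m where "m = (b / (a + b)) *\<^sub>R z + (a / (a + b)) *\<^sub>R y"
  define c where "c = a * b / (a + b)"
  have c: "c > 0" using a b by (simp add: c_def)
  have "heat_kernel a (x - z) * heat_kernel b (x - y) =
      heat_kernel (a + b) (y - z) * heat_kernel c (x - m)" for x
  proof -
    \<comment> \<open>With the weights k + l = 1 all three times become multiples of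
      \<open>c\<close>, and completing the square becomes the identity k|P|^2 + l|Q|^2 = kl|P - Q|^2
      + |kP + lQ|^2.\<close>
    define k l where "k = b / (a + b)" and "l = a / (a + b)"
    have kl: "k + l = 1" "k > 0" "l > 0"
      using a b by (auto simp: k_def l_def add_divide_distrib [symmetric])
    have abc: "a = c / k" "b = c / l" "a + b = c / (k * l)"
      using a b by (auto simp: c_def k_def l_def divide_simps)
    have "k * (norm (x - z))\<^sup>2 + l * (norm (x - y))\<^sup>2 =
        k * l * (norm (y - z))\<^sup>2 + (norm (x - m))\<^sup>2"
    proof -
      have "x - m = (k + l) *\<^sub>R x - (k *\<^sub>R z + l *\<^sub>R y)"
        unfolding kl(1) by (simp add: m_def k_def l_def)
      also have "\<dots> = k *\<^sub>R (x - z) + l *\<^sub>R (x - y)"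
        by (simp add: algebra_simps)
      finally have "x - m = k *\<^sub>R (x - z) + l *\<^sub>R (x - y)" .
      moreover have "y - z = (x - z) - (x - y)" by simp
      moreover have "k * (norm p)\<^sup>2 + l * (norm q)\<^sup>2 =
          k * l * (norm (p - q))\<^sup>2 + (norm (k *\<^sub>R p + l *\<^sub>R q))\<^sup>2" for p q :: 'a
      proof -
        have l: "l = 1 - k" using kl by simp
        show ?thesis
          unfolding power2_norm_eq_inner l
          by (simp add: inner_diff_left inner_diff_right inner_add_left inner_add_right
              inner_commute [of q p] algebra_simps)
      qed
      ultimately show ?thesis by (simp only:)
    qed
    then have "- (norm (x - z))\<^sup>2 / (4 * a) + - (norm (x - y))\<^sup>2 / (4 * b) =
        - (norm (y - z))\<^sup>2 / (4 * (a + b)) + - (norm (x - m))\<^sup>2 / (4 * c)"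
    proof -
      assume *: "k * (norm (x - z))\<^sup>2 + l * (norm (x - y))\<^sup>2 =
        k * l * (norm (y - z))\<^sup>2 + (norm (x - m))\<^sup>2"
      have **: "w / (4 * a) = k * w / (4 * c)" "w / (4 * b) = l * w / (4 * c)"
          "w / (4 * (a + b)) = k * l * w / (4 * c)" for w
        by (subst abc, simp)+
      have "k * - (norm (x - z))\<^sup>2 + l * - (norm (x - y))\<^sup>2 =
          k * l * - (norm (y - z))\<^sup>2 + - (norm (x - m))\<^sup>2"
        using * by simp
      then show ?thesis
        unfolding ** add_divide_distrib [symmetric] by simp
    qed
    then have "exp (- (norm (x - z))\<^sup>2 / (4 * a)) * exp (- (norm (x - y))\<^sup>2 / (4 * b)) =
        exp (- (norm (y - z))\<^sup>2 / (4 * (a + b))) * exp (- (norm (x - m))\<^sup>2 / (4 * c))"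
      by (simp only: exp_add [symmetric])
    moreover have "(4 * pi * a) powr r * (4 * pi * b) powr r =
        (4 * pi * (a + b)) powr r * (4 * pi * c) powr r" for r
    proof -
      have "(4 * pi * a) * (4 * pi * b) = (4 * pi * (a + b)) * (4 * pi * c)"
        using a b by (simp add: c_def)
      from arg_cong [OF this, of "\<lambda>u. u powr r"] show ?thesis
        using a b c by (simp only: powr_mult)
    qed
    moreover have mult_cong: "(p * e) * (q * f) = (p' * e') * (q' * f')"
      if "e * f = e' * f'" "p * q = p' * q'" for p q e f p' q' e' f' :: real
    proof -
      have "(p * e) * (q * f) = (p * q) * (e * f)" by simp
      also have "\<dots> = (p' * e') * (q' * f')" unfolding that by simp
      finally show ?thesis .
    qed
    ultimately show ?thesis
      unfolding heat_kernel_def by (intro mult_cong)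
  qed
  then have "(\<integral>\<^sup>+x. ennreal (heat_kernel a (x - z)) * ennreal (heat_kernel b (x - y)) \<partial>lborel) =
      (\<integral>\<^sup>+x. ennreal (heat_kernel (a + b) (y - z)) * ennreal (heat_kernel c (x - m)) \<partial>lborel)"
    by (simp add: ennreal_mult [symmetric] heat_kernel_nonneg)
  also have "\<dots> = ennreal (heat_kernel (a + b) (y - z))"
    using c by (simp add: nn_integral_cmult nn_integral_heat_kernel)
  finally show ?thesis .
qed

text \<open>The exponential factor increases with time, so passing from r to t loses only the ratio
  of the normalising powers.\<close>

lemma heat_kernel_lower:
  fixes x :: "'a::euclidean_space"
  assumes "0 < r" "r \<le> t"
  shows "(r / t) powr (real DIM('a) / 2) * heat_kernel r x \<le> heat_kernel t x"
proof -
  have "(r / t) powr (real DIM('a) / 2) * (4 * pi * r) powr (- (real DIM('a) / 2)) =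
      (4 * pi * t) powr (- (real DIM('a) / 2))"
    using assms by (simp add: powr_minus powr_divide powr_mult field_simps)
  moreover have "exp (- (norm x)\<^sup>2 / (4 * r)) \<le> exp (- (norm x)\<^sup>2 / (4 * t))"
    using assms by (simp add: frac_le)
  ultimately show ?thesis
    unfolding heat_kernel_def mult.assoc [symmetric] by (simp add: mult_left_mono)
qed

text \<open>Moves the centre of a Gaussian from x to z. By |x-y|^2 <= 2|x-z|^2 + 2|y-z|^2 the part
  of the exponent depending on y is at most |y-z|^2 / (2t), which 2r <= t bounds by |y-z|^2 /
  (4r).\<close>

lemma heat_kernel_shift_lower:
  fixes x y z :: "'a::euclidean_space"
  assumes "0 < r" "2 * r \<le> t"
  shows "(r / t) powr (real DIM('a) / 2) * exp (- (norm (x - z))\<^sup>2 / (2 * t)) * heat_kernel r (y - z)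
     \<le> heat_kernel t (x - y)"
proof -
  have t: "t > 0" using assms by simp
  have "(r / t) powr (real DIM('a) / 2) * (4 * pi * r) powr (- (real DIM('a) / 2)) =
      (4 * pi * t) powr (- (real DIM('a) / 2))"
    using assms t by (simp add: powr_minus powr_divide powr_mult field_simps)
  moreover have "exp (- (norm (x - z))\<^sup>2 / (2 * t)) * exp (- (norm (y - z))\<^sup>2 / (4 * r))
      \<le> exp (- (norm (x - y))\<^sup>2 / (4 * t))"
  proof -
    have "norm (x - y) \<le> norm (x - z) + norm (y - z)"
      using norm_triangle_ineq4 [of "x - z" "y - z"] by simp
    then have "(norm (x - y))\<^sup>2 \<le> (norm (x - z) + norm (y - z))\<^sup>2"
      by (simp add: power_mono)
    also have "\<dots> \<le> 2 * (norm (x - z))\<^sup>2 + 2 * (norm (y - z))\<^sup>2"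
      using sum_squares_bound [of "norm (x - z)" "norm (y - z)"] by (simp add: power2_sum)
    finally have "(norm (x - y))\<^sup>2 / (4 * t) \<le>
        (2 * (norm (x - z))\<^sup>2 + 2 * (norm (y - z))\<^sup>2) / (4 * t)"
      using t by (intro divide_right_mono) auto
    also have "\<dots> = (norm (x - z))\<^sup>2 / (2 * t) + (norm (y - z))\<^sup>2 / (2 * t)"
      by (simp add: add_divide_distrib)
    also have "(norm (y - z))\<^sup>2 / (2 * t) \<le> (norm (y - z))\<^sup>2 / (4 * r)"
      using assms by (intro divide_left_mono) auto
    finally show ?thesis by (simp add: exp_add [symmetric])
  qed
  moreover have mult_le: "p * e * (q * f) \<le> r * g" if "p * q = r" "e * f \<le> g" "0 \<le> r" for p q e f r g :: real
  proof -
    have "p * e * (q * f) = (p * q) * (e * f)" by simp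
    also have "\<dots> \<le> r * g" unfolding that(1) using that(2,3) by (rule mult_left_mono)
    finally show ?thesis .
  qed
  ultimately show ?thesis
    unfolding heat_kernel_def by (intro mult_le) auto
qed

section \<open>Powers with values in [0, infinity] and Jensen's inequality\<close>

lemma ennreal_powr_mono: "v \<le> w \<Longrightarrow> 0 \<le> p \<Longrightarrow> ennreal_powr v p \<le> ennreal_powr w p"
  by (cases v; cases w) (auto simp: ennreal_powr_def powr_mono2 ennreal_leI top_unique)

lemma ennreal_powr_ennreal: "0 \<le> x \<Longrightarrow> ennreal_powr (ennreal x) p = ennreal (x powr p)"
  by (simp add: ennreal_powr_def)

lemma ennreal_powr_cmult:
  "0 < c \<Longrightarrow> ennreal_powr (ennreal c * v) p = ennreal (c powr p) * ennreal_powr v p"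
  by (cases v) (auto simp: ennreal_powr_def powr_mult ennreal_mult [symmetric] ennreal_mult_top ennreal_top_mult)

lemma borel_measurable_ennreal_powr [measurable (raw)]:
  assumes [measurable]: "f \<in> borel_measurable M"
  shows "(\<lambda>x. ennreal_powr (f x) p) \<in> borel_measurable M"
  unfolding ennreal_powr_def by measurable

text \<open>Integrating the tangent line inequality \<open>u\<^sup>p + (p-1) l\<^sup>p \<ge> p l\<^bsup>p-1\<^esup> u\<close> and then taking for \<open>l\<close> the mean of
  \<open>u\<close> avoids any integrability hypothesis.\<close>
lemma nn_integral_jensen_powr:
  assumes M: "emeasure M (space M) = 1" and p: "1 < p" and u [measurable]: "u \<in> borel_measurable M"
  shows "ennreal_powr (\<integral>\<^sup>+x. u x \<partial>M) p \<le> (\<integral>\<^sup>+x. ennreal_powr (u x) p \<partial>M)"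
proof -
  have tangent_real: "p * l powr (p - 1) * v \<le> v powr p + (p - 1) * l powr p"
    if "0 < l" "0 \<le> v" for l v :: real
  proof (cases "v = 0")
    case True then show ?thesis using p by simp
  next
    case False
    then have v: "v > 0" using that by simp
    have *: "p * l powr (p - 1) * (v - l) \<le> v powr p - l powr p"
    proof (rule convex_on_imp_above_tangent)
      show "convex_on {0<..} (\<lambda>x. x powr p)"
        using p by (intro convex_on_subset [OF powr_convex]) auto
      show "((\<lambda>x. x powr p) has_field_derivative p * l powr (p - 1)) (at l within {0<..})"
        using that by (auto intro!: derivative_eq_intros)
    qed (use that v in \<open>auto simp: interior_open\<close>)
    have "l powr p = l * l powr (p - 1)"
      using that by (simp add: powr_diff)
    with * show ?thesis by (simp add: algebra_simps)
  qed
  have tangent: "ennreal (p * l powr (p - 1)) * v \<le> ennreal_powr v p + ennreal ((p - 1) * l powr p)"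
    if "0 < l" for l :: real and v :: ennreal
    using tangent_real [OF that] p
    by (cases v) (auto simp: ennreal_powr_def ennreal_mult [symmetric] ennreal_plus [symmetric]
        simp del: ennreal_plus intro!: ennreal_leI)
  have int: "ennreal (p * l powr (p - 1)) * (\<integral>\<^sup>+x. u x \<partial>M) \<le>
      (\<integral>\<^sup>+x. ennreal_powr (u x) p \<partial>M) + ennreal ((p - 1) * l powr p)" if "0 < l" for l :: real
  proof -
    have "ennreal (p * l powr (p - 1)) * (\<integral>\<^sup>+x. u x \<partial>M) = (\<integral>\<^sup>+x. ennreal (p * l powr (p - 1)) * u x \<partial>M)"
      by (simp add: nn_integral_cmult)
    also have "\<dots> \<le> (\<integral>\<^sup>+x. ennreal_powr (u x) p + ennreal ((p - 1) * l powr p) \<partial>M)"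
      by (intro nn_integral_mono tangent that)
    also have "\<dots> = (\<integral>\<^sup>+x. ennreal_powr (u x) p \<partial>M) + ennreal ((p - 1) * l powr p)"
      using M by (simp add: nn_integral_add)
    finally show ?thesis .
  qed
  show ?thesis
  proof (cases "\<integral>\<^sup>+x. u x \<partial>M")
    \<comment> \<open>If the mean is infinite, the tangent at l = 1 already forces the right-hand
      side to be infinite.\<close>
    case top
    have "(\<integral>\<^sup>+x. ennreal_powr (u x) p \<partial>M) = top"
      using int [of 1] p by (simp add: top ennreal_mult_top top_unique ennreal_add_eq_top)
    then show ?thesis by simp
  next
    case (real l)
    show ?thesis
    proof (cases "l = 0")
      case True then show ?thesis using real by (simp add: ennreal_powr_def)
    next
      case False
      then have l: "l > 0" using real by simp
      have lp: "l powr (p - 1) * l = l powr p" using l by (simp add: powr_diff)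
      \<comment> \<open>With l equal to the mean, the tangent term p l^(p-1) l splits as l^p + (p-1)
        l^p, and the finite summand (p-1) l^p cancels.\<close>
      have "ennreal (l powr p) + ennreal ((p - 1) * l powr p) = ennreal (p * l powr (p - 1)) * ennreal l"
        using p l lp by (simp add: ennreal_plus [symmetric] ennreal_mult [symmetric] mult.assoc
            del: ennreal_plus) (simp add: algebra_simps)
      also have "\<dots> \<le> (\<integral>\<^sup>+x. ennreal_powr (u x) p \<partial>M) + ennreal ((p - 1) * l powr p)"
        using int [OF l] real by simp
      finally show ?thesis
        using real l by (simp add: ennreal_powr_ennreal add_left_mono ennreal_add_left_cancel_le add.commute)
    qed
  qed
qed

subsection \<open>Blow-up for integral inequalities\<close>

text \<open>A discrete form of the blow-up of \<open>W' = g W\<^sup>p\<close>: with \<open>V\<close> the primitive of \<open>g\<close>, the right-hand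
  side doubles from \<open>2\<^sup>n a\<close> to \<open>2\<^bsup>n+1\<^esup> a\<close> each time \<open>V\<close> increases by \<open>(2\<^sup>n a)\<^bsup>1-p\<^esup>\<close>, and these
  increments are summable.\<close>
lemma superlinear_integral_inequality_blowup:
  fixes w :: "real \<Rightarrow> ennreal" and g :: "real \<Rightarrow> real"
  assumes w [measurable]: "w \<in> borel_measurable borel"
    and g [measurable]: "g \<in> borel_measurable borel"
    and g_cont: "continuous_on {t0..t1} g" and g_nonneg: "\<And>t. t \<in> {t0..t1} \<Longrightarrow> 0 \<le> g t"
    and t01: "t0 < t1" and a: "0 < a" and p: "1 < p"
    and ineq: "AE t in lborel. t0 < t \<and> t < t1 \<longrightarrow>
        ennreal a + (\<integral>\<^sup>+s\<in>{t0<..<t}. ennreal (g s) * ennreal_powr (w s) p \<partial>lborel) \<le> w t"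
    and large: "a powr (1 - p) / (1 - 2 powr (1 - p)) < integral {t0..t1} g"
  obtains t2 where "t0 \<le> t2" "t2 < t1" "AE t in lborel. t2 < t \<and> t < t1 \<longrightarrow> w t = \<infinity>"
proof -
  \<comment> \<open>\<open>S n\<close> is the increase of \<open>V\<close> that pays for the first n
    doublings. It is a partial sum of a geometric series with ratio \<open>q\<close> and sum
    \<open>L\<close>, so \<open>large\<close> says that \<open>V\<close> exceeds \<open>L\<close> at
    t1.\<close>
  define V where "V = (\<lambda>t. integral {t0..t} g)"
  define W where "W = (\<lambda>t. ennreal a + (\<integral>\<^sup>+s\<in>{t0<..<t}. ennreal (g s) * ennreal_powr (w s) p \<partial>lborel))"
  define L where "L = a powr (1 - p) / (1 - 2 powr (1 - p))"
  define S where "S = (\<lambda>n. \<Sum>k<n. (2 ^ k * a) powr (1 - p))"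
  define q :: real where "q = 2 powr (1 - p)"
  have q: "0 < q" "q < 1"
    using p by (auto simp: q_def powr_less_one)
  have int: "g integrable_on {r..t}" if "t0 \<le> r" "t \<le> t1" for r t
    using that g_cont by (intro integrable_continuous_real continuous_on_subset [OF g_cont]) auto
  have V_diff: "V t - V r = integral {r..t} g" if "t0 \<le> r" "r \<le> t" "t \<le> t1" for r t
    using Henstock_Kurzweil_Integration.integral_combine [of t0 r t g] that int by (simp add: V_def)
  have V_mono: "V r \<le> V t" if "t0 \<le> r" "r \<le> t" "t \<le> t1" for r t
    using V_diff [OF that] that g_nonneg integral_nonneg [OF int, of r t] by (simp add: V_def)
  have V_cont: "continuous_on {t0..t1} V"
    unfolding V_def using int by (intro indefinite_integral_continuous_1) auto
  have S_eq: "S n = a powr (1 - p) * (\<Sum>k<n. q ^ k)" for n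
  proof -
    have "(2 ^ k * a) powr (1 - p) = a powr (1 - p) * q ^ k" for k
      using a by (simp add: q_def powr_mult powr_powr mult.commute flip: powr_realpow)
    then show ?thesis by (simp add: S_def sum_distrib_left)
  qed
  have S_le: "S n \<le> L" for n
  proof -
    have "(\<Sum>k<n. q ^ k) \<le> (\<Sum>k. q ^ k)"
      using q by (intro sum_le_suminf summable_geometric) auto
    also have "\<dots> = 1 / (1 - q)" using q by (simp add: suminf_geometric)
    finally have "a powr (1 - p) * (\<Sum>k<n. q ^ k) \<le> a powr (1 - p) * (1 / (1 - q))"
      by (intro mult_left_mono) auto
    then show ?thesis by (simp add: S_eq L_def q_def)
  qed
  have S_nonneg: "0 \<le> S n" for n by (auto simp: S_def intro: sum_nonneg)
  have V0: "V t0 = 0" by (simp add: V_def)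
  \<comment> \<open>Where w is at least b the integrand is at least g b^p, and the integral of g
    over (r, t) is the increase of \<open>V\<close>.\<close>
  have W_step: "W r + ennreal ((V t - V r) * b powr p) \<le> W t"
    if rt: "t0 \<le> r" "r \<le> t" "t \<le> t1" and b: "0 \<le> b"
      and wb: "AE s in lborel. r < s \<and> s < t \<longrightarrow> ennreal b \<le> w s" for r t b
  proof -
    have "(g has_integral (V t - V r)) {r..t}"
      unfolding V_diff [OF rt] using int [of r t] rt by (simp add: integrable_integral)
    then have "((\<lambda>s. if s \<in> {r<..<t} then g s else 0) has_integral (V t - V r)) UNIV"
      unfolding has_integral_restrict_UNIV by (simp add: has_integral_Icc_iff_Ioo)
    moreover have "(\<lambda>s. if s \<in> {r<..<t} then g s else 0) = (\<lambda>s. indicator {r<..<t} s * g s)"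
      by (auto simp: indicator_def)
    ultimately have "((\<lambda>s. indicator {r<..<t} s * g s) has_integral (V t - V r)) UNIV"
      by simp
    then have g_nn: "(\<integral>\<^sup>+s. ennreal (indicator {r<..<t} s * g s) \<partial>lborel) = ennreal (V t - V r)"
      using rt g_nonneg
      by (intro nn_integral_has_integral_lborel)
         (auto simp: indicator_def)
    have "ennreal ((V t - V r) * b powr p) = ennreal (b powr p) * (\<integral>\<^sup>+s. ennreal (indicator {r<..<t} s * g s) \<partial>lborel)"
      using V_mono [OF rt] unfolding g_nn by (simp add: ennreal_mult [symmetric] mult.commute)
    also have "\<dots> = (\<integral>\<^sup>+s. ennreal (b powr p) * ennreal (indicator {r<..<t} s * g s) \<partial>lborel)"
      by (simp add: nn_integral_cmult)
    also have "\<dots> \<le> (\<integral>\<^sup>+s\<in>{r<..<t}. ennreal (g s) * ennreal_powr (w s) p \<partial>lborel)"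
    proof (rule nn_integral_mono_AE)
      show "AE s in lborel. ennreal (b powr p) * ennreal (indicator {r<..<t} s * g s) \<le>
          ennreal (g s) * ennreal_powr (w s) p * indicator {r<..<t} s"
        using wb
      proof eventually_elim
        case (elim s)
        show ?case
        proof (cases "r < s \<and> s < t")
          case True
          then have "ennreal (b powr p) \<le> ennreal_powr (w s) p"
            using ennreal_powr_mono [of "ennreal b" "w s" p] elim b p by (simp add: ennreal_powr_ennreal)
          then show ?thesis using True by (simp add: mult.commute mult_left_mono)
        qed (auto simp: indicator_def)
      qed
    qed
    finally have "ennreal ((V t - V r) * b powr p) \<le> \<dots>" .
    then have "W r + ennreal ((V t - V r) * b powr p) \<le>
        ennreal a + ((\<integral>\<^sup>+s\<in>{t0<..<r}. ennreal (g s) * ennreal_powr (w s) p \<partial>lborel) +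
          (\<integral>\<^sup>+s\<in>{r<..<t}. ennreal (g s) * ennreal_powr (w s) p \<partial>lborel))"
      unfolding W_def by (simp add: add.assoc add_left_mono)
    also have "\<dots> = ennreal a + (\<integral>\<^sup>+s. ennreal (g s) * ennreal_powr (w s) p * indicator {t0<..<r} s +
          ennreal (g s) * ennreal_powr (w s) p * indicator {r<..<t} s \<partial>lborel)"
      by (simp add: nn_integral_add)
    \<comment> \<open>The intervals (t0, r) and (r, t) are disjoint and both lie in (t0, t); only
      the point r may be missed.\<close>
    also have "\<dots> \<le> W t"
      unfolding W_def using rt
      by (intro add_left_mono nn_integral_mono) (auto simp: indicator_def)
    finally show ?thesis .
  qed
  \<comment> \<open>Induction step: choose r with \<open>V r = S n\<close> by the intermediate value
    theorem. After r, w dominates W, which is at least 2^n a, and the further increase of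
    \<open>V\<close> by (2^n a)^(1-p) adds (2^n a)^(1-p) (2^n a)^p = 2^n a to W.\<close>
  have doubling: "ennreal (2 ^ n * a) \<le> W t" if "t \<in> {t0..t1}" "S n \<le> V t" for n t
    using that
  proof (induction n arbitrary: t)
    case 0
    then show ?case by (simp add: W_def)
  next
    case (Suc n)
    have "S n \<le> S (Suc n)" by (simp add: S_def)
    then have "S n \<le> V t" using Suc.prems by simp
    then obtain r where r: "t0 \<le> r" "r \<le> t" "V r = S n"
      using IVT' [of V t0 "S n" t] V0 S_nonneg Suc.prems(1) continuous_on_subset [OF V_cont, of "{t0..t}"]
      by auto
    have "AE s in lborel. r < s \<and> s < t \<longrightarrow> ennreal (2 ^ n * a) \<le> w s"
      using ineq
    proof eventually_elim
      case (elim s)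
      show ?case
      proof
        assume s: "r < s \<and> s < t"
        then have "ennreal (2 ^ n * a) \<le> W s"
          using r Suc.prems V_mono [of r s] by (intro Suc.IH) auto
        also have "\<dots> \<le> w s" using elim s r Suc.prems by (simp add: W_def)
        finally show "ennreal (2 ^ n * a) \<le> w s" .
      qed
    qed
    then have "W r + ennreal ((V t - V r) * (2 ^ n * a) powr p) \<le> W t"
      using r Suc.prems a by (intro W_step) auto
    moreover have "ennreal (2 ^ n * a) \<le> W r"
      using r Suc.prems by (intro Suc.IH) auto
    moreover have "2 ^ n * a \<le> (V t - V r) * (2 ^ n * a) powr p"
    proof -
      have "(2 ^ n * a) powr (1 - p) \<le> V t - V r"
        using Suc.prems(2) r by (simp add: S_def)
      then have "(2 ^ n * a) powr (1 - p) * (2 ^ n * a) powr p \<le> (V t - V r) * (2 ^ n * a) powr p"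
        by (rule mult_right_mono) simp
      then show ?thesis using a by (simp add: powr_add [symmetric])
    qed
    ultimately have "ennreal (2 ^ n * a) + ennreal (2 ^ n * a) \<le> W t"
      by (meson add_mono ennreal_leI order_trans)
    moreover have "ennreal (2 ^ n * a) + ennreal (2 ^ n * a) = ennreal (2 ^ Suc n * a)"
      using a by (subst ennreal_plus [symmetric]) auto
    ultimately show ?case by simp
  qed
  have "0 \<le> L" using S_le [of 0] by (simp add: S_def)
  moreover have "L \<le> V t1" using large by (simp add: L_def V_def)
  \<comment> \<open>At t2 the primitive \<open>V\<close> has reached the bound \<open>L\<close> of
    all \<open>S n\<close>, so from there on every doubling has taken place. Strictness in
    \<open>large\<close> keeps t2 away from t1.\<close>
  ultimately obtain t2 where t2: "t0 \<le> t2" "t2 \<le> t1" "V t2 = L"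
    using IVT' [of V t0 L t1] V0 t01 V_cont by auto
  moreover have "t2 \<noteq> t1" using t2 large by (auto simp: L_def V_def)
  moreover have "AE t in lborel. t2 < t \<and> t < t1 \<longrightarrow> w t = \<infinity>"
    using ineq
  proof eventually_elim
    case (elim t)
    show ?case
    proof
      assume t: "t2 < t \<and> t < t1"
      have le: "ennreal (2 ^ n * a) \<le> w t" for n
      proof -
        have "ennreal (2 ^ n * a) \<le> W t"
          using t t2 V_mono [of t2 t] S_le [of n] by (intro doubling) auto
        also have "\<dots> \<le> w t" using elim t t2 by (simp add: W_def)
        finally show ?thesis .
      qed
      show "w t = \<infinity>"
      proof (cases "w t")
        case (real x)
        obtain n where "x / a < 2 ^ n" using real_arch_pow [of 2 "x / a"] by auto
        then have "x < 2 ^ n * a" using a by (simp add: field_simps)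
        then show ?thesis using le [of n] real a by simp
      qed simp
    qed
  qed
  ultimately show thesis using that by auto
qed

subsection \<open>Mass of the density near the origin\<close>

text \<open>Restrict the Gamma integral to [b, infinity), where t^x is at least b^x. Since b is
  free, this makes the Mittag-Leffler coefficients decay faster than any prescribed geometric
  sequence.\<close>

lemma Gamma_ge_powr_exp:
  fixes b x :: real
  assumes b: "0 < b" and x: "0 \<le> x"
  shows "b powr x * exp (- b) \<le> Gamma (x + 1)"
proof -
  have "((\<lambda>t. b powr x * exp (- 1 * t)) has_integral b powr x * (exp (- 1 * b) / 1)) {b..}"
    by (intro has_integral_mult_right has_integral_exp_minus_to_infinity) simp
  then have "((\<lambda>t. if t \<in> {b..} then b powr x * exp (- 1 * t) else 0) has_integral
      b powr x * (exp (- 1 * b) / 1)) {0..}"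
    using b by (subst has_integral_restrict) auto
  moreover have "((\<lambda>t. t powr (x + 1 - 1) / exp t) has_integral Gamma (x + 1)) {0..}"
    using x by (intro Gamma_integral_real) simp
  ultimately have "b powr x * (exp (- 1 * b) / 1) \<le> Gamma (x + 1)"
  proof (rule has_integral_le)
    fix t :: real assume "t \<in> {0..}"
    then show "(if t \<in> {b..} then b powr x * exp (- 1 * t) else 0) \<le> t powr (x + 1 - 1) / exp t"
      using b x by (auto simp: exp_minus field_simps intro!: powr_mono2)
  qed
  then show ?thesis by simp
qed

text \<open>For exponents in [0, 1] one has t^x <= 1 + t, so the Gamma integral is at most Gamma 1 +
  Gamma 2.\<close>

lemma Gamma_le_2:
  fixes x :: real
  assumes x: "0 \<le> x" "x \<le> 1"
  shows "Gamma (x + 1) \<le> 2"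
proof -
  have "((\<lambda>t. t powr (x + 1 - 1) / exp t) has_integral Gamma (x + 1)) {0..}"
    using x by (intro Gamma_integral_real) simp
  moreover have "((\<lambda>t::real. t powr (1 - 1) / exp t + t powr (2 - 1) / exp t) has_integral
      Gamma 1 + Gamma 2) {0..}"
    by (intro has_integral_add Gamma_integral_real) auto
  ultimately have "Gamma (x + 1) \<le> Gamma 1 + Gamma 2"
  proof (rule has_integral_le)
    fix t :: real assume t: "t \<in> {0..}"
    show "t powr (x + 1 - 1) / exp t \<le> t powr (1 - 1) / exp t + t powr (2 - 1) / exp t"
    proof (cases "t = 0")
      case False
      then have "t > 0" using t by simp
      then have "t powr x \<le> 1 + t"
        using x powr_mono [of x 1 t] powr_mono2 [of x t 1] by (cases "t \<le> 1") auto
      then show ?thesis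
        using \<open>t > 0\<close> by (simp add: add_divide_distrib [symmetric] divide_right_mono)
    qed simp
  qed
  also have "Gamma (1::real) + Gamma 2 = 2"
    using Gamma_fact [of 1, where 'a = real] by simp
  finally show ?thesis .
qed

text \<open>All terms of both series are nonnegative. The first two terms at 1 give 1 + 1 / Gamma(a
  + 1) >= 3/2, and a geometric majorant that depends on the order only through a0 bounds the value
  at 2.\<close>

lemma mittag_leffler_bounds:
  fixes a0 a :: real
  assumes a: "0 < a0" "a0 \<le> a" "a \<le> 1"
  shows "3 / 2 \<le> Re (mittag_leffler a 1 1)"
    and "Re (mittag_leffler a 1 2) \<le> 2 * exp (4 powr (1 / a0))"
proof -
  define f where "f = (\<lambda>z k. z ^ k / Gamma (a * real k + 1))"
  \<comment> \<open>This b satisfies b^(ak) >= 4^k for all a >= a0, so the terms at z <= 2 are at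
    most e^b 2^(-k).\<close>
  define b :: real where "b = 4 powr (1 / a0)"
  have Gamma_pos: "Gamma (a * real k + 1) > 0" for k
    using a by (intro Gamma_real_pos add_nonneg_pos mult_nonneg_nonneg) auto
  have f_le: "f z k \<le> exp b * (1 / 2) ^ k" if z: "0 \<le> z" "z \<le> 2" for z k
  proof -
    have "(4::real) ^ k = 4 powr real k" by (simp add: powr_realpow)
    also have "\<dots> \<le> 4 powr (1 / a0 * (a * real k))"
    proof (rule powr_mono)
      show "real k \<le> 1 / a0 * (a * real k)"
        using a mult_right_mono [of a0 a "real k"] by (simp add: field_simps)
    qed simp
    also have "\<dots> = b powr (a * real k)" by (simp add: b_def powr_powr)
    finally have "4 ^ k * exp (- b) \<le> b powr (a * real k) * exp (- b)" by simp
    also have "\<dots> \<le> Gamma (a * real k + 1)"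
      using a by (intro Gamma_ge_powr_exp) (auto simp: b_def)
    finally have "f z k \<le> 2 ^ k / (4 ^ k * exp (- b))"
      unfolding f_def using z by (intro frac_le power_mono) auto
    also have "\<dots> = exp b * (1 / 2) ^ k"
      by (simp add: exp_minus field_simps flip: power_mult_distrib)
    finally show ?thesis .
  qed
  have f_nonneg: "0 \<le> f z k" if "0 \<le> z" for z k
    using that Gamma_pos [of k] by (simp add: f_def)
  have summ: "summable (f z)" if "0 \<le> z" "z \<le> 2" for z
    using f_le [OF that] f_nonneg that
    by (intro summable_comparison_test' [of "\<lambda>k. exp b * (1 / 2) ^ k" 0 "f z"] summable_mult
        summable_geometric) auto
  have Re: "Re (mittag_leffler a 1 (of_real z)) = (\<Sum>k. f z k)" if "0 \<le> z" "z \<le> 2" for z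
  proof -
    have "mittag_leffler a 1 (of_real z) = (\<Sum>k. of_real (f z k))"
      by (simp add: mittag_leffler_def f_def)
    also have "\<dots> = of_real (\<Sum>k. f z k)"
      using summ [OF that] by (rule suminf_of_real [symmetric])
    finally show ?thesis by simp
  qed
  have "3 / 2 \<le> 1 + 1 / Gamma (a + 1)"
    using Gamma_le_2 [of a] Gamma_pos [of 1] a by (simp add: field_simps)
  also have "\<dots> = (\<Sum>k<2. f 1 k)"
    by (simp add: f_def numeral_2_eq_2)
  also have "\<dots> \<le> (\<Sum>k. f 1 k)"
    by (intro sum_le_suminf summ) (auto intro: f_nonneg)
  also have "\<dots> = Re (mittag_leffler a 1 1)"
    using Re [of 1] by simp
  finally show "3 / 2 \<le> Re (mittag_leffler a 1 1)" .
  have "Re (mittag_leffler a 1 2) = (\<Sum>k. f 2 k)"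
    using Re [of 2] by simp
  also have "\<dots> \<le> (\<Sum>k. exp b * (1 / 2) ^ k)"
    by (intro suminf_le summ f_le summable_mult summable_geometric) auto
  also have "\<dots> = 2 * exp b"
    by (simp add: suminf_mult summable_geometric suminf_geometric)
  finally show "Re (mittag_leffler a 1 2) \<le> 2 * exp (4 powr (1 / a0))"
    by (simp add: b_def)
qed

section \<open>From exponential moments to mass on a bounded interval\<close>

lemma h_density_pos: "is_h_density \<alpha> h \<Longrightarrow> 0 < t \<Longrightarrow> 0 < h t"
  by (simp add: is_h_density_def)

lemma h_density_measurable:
  assumes "is_h_density \<alpha> h"
  shows "(\<lambda>t. indicator {0<..} t * h t) \<in> borel_measurable borel"
  using assms by (simp add: is_h_density_def set_borel_measurable_def)

text \<open>For real z the complex integrand in the definition of the density is real and, as h is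
  positive, nonnegative. The defining identity therefore passes to the nonnegative integral.\<close>

lemma h_density_exp_moment:
  assumes h: "is_h_density \<alpha> h"
  shows "(\<integral>\<^sup>+t\<in>{0<..}. ennreal (h t * exp (z * t)) \<partial>lborel) = ennreal (Re (mittag_leffler \<alpha> 1 (of_real z)))"
proof -
  let ?f = "\<lambda>t. indicator {0<..} t * (h t * exp (z * t))"
  have cf: "indicator {0<..} t *\<^sub>R (complex_of_real (h t) * exp (of_real z * of_real t)) =
      complex_of_real (?f t)" for t
    by (simp add: scaleR_conv_of_real exp_of_real [symmetric])
  have "integrable lborel (\<lambda>t. complex_of_real (?f t))"
    and int: "(\<integral>t. complex_of_real (?f t) \<partial>lborel) = mittag_leffler \<alpha> 1 (of_real z)"
    using h unfolding is_h_density_def set_integrable_def set_lebesgue_integral_def cf [symmetric]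
    by blast+
  then have "integrable lborel ?f" by (simp only: complex_of_real_integrable_eq)
  then have "(\<integral>\<^sup>+t. ennreal (?f t) \<partial>lborel) = ennreal (\<integral>t. ?f t \<partial>lborel)"
    using h_density_pos [OF h]
    by (intro nn_integral_eq_integral) (auto simp: indicator_def less_imp_le intro!: AE_I2)
  also have "(\<integral>t. ?f t \<partial>lborel) = Re (mittag_leffler \<alpha> 1 (of_real z))"
    unfolding int [symmetric] by (simp only: integral_complex_of_real Re_complex_of_real)
  also have "(\<integral>\<^sup>+t. ennreal (?f t) \<partial>lborel) = (\<integral>\<^sup>+t\<in>{0<..}. ennreal (h t * exp (z * t)) \<partial>lborel)"
    by (intro nn_integral_cong) (auto simp: indicator_def)
  finally show ?thesis by simp
qed

text \<open>The lower bounds come from \<open>e\<^sup>\<theta> \<le> 1 + e\<^sup>A \<theta> 1\<^bsub>\<theta> \<le> A\<^esub> + e\<^bsup>-A\<^esup> e\<^bsup>2\<theta>\<^esup>\<close>, integrated against \<open>h\<close>.\<close>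
lemma h_density_mass_bound:
  assumes a0: "0 < a0"
  obtains A c :: real where "0 < A" "0 < c"
    "\<And>\<alpha> h. a0 \<le> \<alpha> \<Longrightarrow> \<alpha> < 1 \<Longrightarrow> is_h_density \<alpha> h \<Longrightarrow>
      ennreal c \<le> (\<integral>\<^sup>+t\<in>{0<..A}. ennreal (h t) \<partial>lborel) \<and>
      ennreal c \<le> (\<integral>\<^sup>+t\<in>{0<..A}. ennreal (t * h t) \<partial>lborel)"
proof -
  define K where "K = 2 * exp (4 powr (1 / a0))"
  \<comment> \<open>\<open>K\<close> bounds the exponential moment of order 2. With e^(-A) K = 1/4
    the integrated inequality reads 3/2 <= 1 + e^A J + 1/4, whence J >= e^(-A) / 4.\<close>
  define A where "A = ln (4 * K)"
  have K: "K \<ge> 2" by (simp add: K_def)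
  then have A: "A > 0" "exp (- A) * K = 1 / 4" by (auto simp: A_def exp_minus)
  \<comment> \<open>The first entry bounds the mass of \<theta> h on (0, A]; the second, smaller by
    the factor A, bounds that of h, because \<theta> <= A there.\<close>
  define c where "c = min (exp (- A) / 4) (exp (- A) / (4 * A))"
  have "c > 0" using A by (simp add: c_def)
  moreover have "ennreal c \<le> (\<integral>\<^sup>+t\<in>{0<..A}. ennreal (h t) \<partial>lborel)"
      "ennreal c \<le> (\<integral>\<^sup>+t\<in>{0<..A}. ennreal (t * h t) \<partial>lborel)"
    if \<alpha>: "a0 \<le> \<alpha>" "\<alpha> < 1" and h: "is_h_density \<alpha> h" for \<alpha> h
  proof -
    note h_pos = h_density_pos [OF h]
    \<comment> \<open>Extension by zero, since h is unspecified, and possibly not measurable,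
      outside (0, infinity).\<close>
    define k where "k = (\<lambda>t. indicator {0<..} t * h t)"
    have k [measurable]: "k \<in> borel_measurable borel"
      unfolding k_def by (rule h_density_measurable [OF h])
    have k_nonneg: "0 \<le> k t" for t
      using h_pos by (auto simp: k_def indicator_def less_imp_le)
    define J where "J = (\<integral>\<^sup>+t. ennreal (indicator {0<..A} t * (t * k t)) \<partial>lborel)"
    have J: "(\<integral>\<^sup>+t\<in>{0<..A}. ennreal (t * h t) \<partial>lborel) = J"
      unfolding J_def k_def by (intro nn_integral_cong) (auto simp: indicator_def)
    have moment: "(\<integral>\<^sup>+t. ennreal (k t * exp (z * t)) \<partial>lborel) = ennreal (Re (mittag_leffler \<alpha> 1 (of_real z)))"
      for z
      unfolding h_density_exp_moment [OF h, symmetric] k_def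
      by (intro nn_integral_cong) (auto simp: indicator_def)
    have mass: "(\<integral>\<^sup>+t. ennreal (k t) \<partial>lborel) = 1"
    proof -
      have "(\<integral>\<^sup>+t. ennreal (k t) \<partial>lborel) = (\<integral>\<^sup>+t\<in>{0<..}. ennreal (h t) \<partial>lborel)"
        unfolding k_def by (intro nn_integral_cong) (auto simp: indicator_def)
      then show ?thesis using h by (simp add: is_h_density_def)
    qed
    have "ennreal (3 / 2) \<le> (\<integral>\<^sup>+t. ennreal (k t * exp (1 * t)) \<partial>lborel)"
      unfolding moment using mittag_leffler_bounds(1) [of a0 \<alpha>] a0 \<alpha> by (intro ennreal_leI) simp
    also have "\<dots> \<le> (\<integral>\<^sup>+t. ennreal (k t) + (ennreal (exp A) * ennreal (indicator {0<..A} t * (t * k t)) +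
        ennreal (exp (- A)) * ennreal (k t * exp (2 * t))) \<partial>lborel)"
    proof (rule nn_integral_mono)
      fix t :: real
      have "k t * exp t \<le> k t + (exp A * (indicator {0<..A} t * (t * k t)) + exp (- A) * (k t * exp (2 * t)))"
      proof (cases "0 < t")
        case True
        have "exp t \<le> 1 + (exp A * (indicator {0<..A} t * t) + exp (- A) * exp (2 * t))"
        proof (cases "t \<le> A")
          case t: True
          \<comment> \<open>This rearranges to e^t <= 1 + t e^t, and t e^t <= t e^A for t <= A. For
            t > A the bound t <= 2t - A is used instead.\<close>
          have "1 - t \<le> exp (- t)" using exp_ge_add_one_self [of "- t"] by simp
          then have "exp t * (1 - t) \<le> 1"
            by (metis exp_ge_zero exp_minus_inverse mult_left_mono)
          moreover have "t * exp t \<le> t * exp A" using t True by simp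
          ultimately have "exp t \<le> 1 + exp A * t" by (simp add: algebra_simps)
          moreover have "0 \<le> exp (- A) * exp (2 * t)" by simp
          moreover have "indicator {0<..A} t = (1::real)" using t True by simp
          ultimately show ?thesis by (simp only: mult_1)
        next
          case False
          then have "exp t \<le> exp (2 * t - A)" by simp
          then have "exp t \<le> exp (- A) * exp (2 * t)" by (simp add: exp_diff exp_minus field_simps)
          then show ?thesis using False by simp
        qed
        from mult_left_mono [OF this k_nonneg [of t]] show ?thesis
          by (simp add: algebra_simps)
      qed (simp add: k_def)
      then show "ennreal (k t * exp (1 * t)) \<le> ennreal (k t) +
          (ennreal (exp A) * ennreal (indicator {0<..A} t * (t * k t)) +
            ennreal (exp (- A)) * ennreal (k t * exp (2 * t)))"
        using k_nonneg [of t]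
        by (subst (1 2) ennreal_mult [symmetric])
          (auto simp: ennreal_plus [symmetric] indicator_def simp del: ennreal_plus intro!: ennreal_leI)
    qed
    also have "\<dots> = 1 + (ennreal (exp A) * J + ennreal (exp (- A)) * ennreal (Re (mittag_leffler \<alpha> 1 (of_real 2))))"
      unfolding J_def by (subst moment [symmetric]) (simp add: nn_integral_add nn_integral_cmult mass)
    also have "\<dots> \<le> 1 + (ennreal (exp A) * J + ennreal (exp (- A)) * ennreal K)"
      using mittag_leffler_bounds(2) [of a0 \<alpha>] a0 \<alpha>
      by (intro add_left_mono mult_left_mono ennreal_leI) (auto simp: K_def)
    also have "\<dots> = 1 + (ennreal (exp A) * J + ennreal (1 / 4))"
      using K A by (simp add: ennreal_mult [symmetric])
    finally have *: "ennreal (3 / 2) \<le> 1 + (ennreal (exp A) * J + ennreal (1 / 4))" .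
    have J_ge: "ennreal (exp (- A) / 4) \<le> J"
    proof (cases J)
      case (real j)
      have "1 + (ennreal (exp A) * J + ennreal (1 / 4)) = ennreal (1 + (exp A * j + 1 / 4))"
        using real by (subst ennreal_plus, simp, simp, subst ennreal_plus) (simp_all add: ennreal_mult)
      then have "ennreal (3 / 2) \<le> ennreal (1 + (exp A * j + 1 / 4))"
        using * by metis
      then have "3 / 2 \<le> 1 + (exp A * j + 1 / 4)"
        using real by (subst (asm) ennreal_le_iff) auto
      then show ?thesis using real by (auto simp: exp_minus field_simps intro!: ennreal_leI)
    qed simp
    have J_le: "J \<le> ennreal A * (\<integral>\<^sup>+t\<in>{0<..A}. ennreal (h t) \<partial>lborel)"
    proof -
      have "J \<le> (\<integral>\<^sup>+t. ennreal A * ennreal (indicator {0<..A} t * k t) \<partial>lborel)"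
        unfolding J_def using k_nonneg A
        by (intro nn_integral_mono) (auto simp: indicator_def ennreal_mult [symmetric]
            intro!: ennreal_leI mult_right_mono)
      also have "\<dots> = ennreal A * (\<integral>\<^sup>+t. ennreal (indicator {0<..A} t * k t) \<partial>lborel)"
        by (simp add: nn_integral_cmult)
      also have "(\<integral>\<^sup>+t. ennreal (indicator {0<..A} t * k t) \<partial>lborel) = (\<integral>\<^sup>+t\<in>{0<..A}. ennreal (h t) \<partial>lborel)"
        unfolding k_def by (intro nn_integral_cong) (auto simp: indicator_def)
      finally show ?thesis .
    qed
    show "ennreal c \<le> (\<integral>\<^sup>+t\<in>{0<..A}. ennreal (t * h t) \<partial>lborel)"
      unfolding J by (rule order_trans [OF ennreal_leI J_ge]) (simp add: c_def)
    have "ennreal (exp (- A) / (4 * A)) \<le> (\<integral>\<^sup>+t\<in>{0<..A}. ennreal (h t) \<partial>lborel)"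
    proof (cases "\<integral>\<^sup>+t\<in>{0<..A}. ennreal (h t) \<partial>lborel")
      case (real r)
      then have "ennreal (exp (- A) / 4) \<le> ennreal (A * r)"
        using order_trans [OF J_ge J_le] A by (simp add: ennreal_mult)
      then show ?thesis
        using real A by (subst (asm) ennreal_le_iff) (auto simp: field_simps intro!: ennreal_leI)
    qed simp
    then show "ennreal c \<le> (\<integral>\<^sup>+t\<in>{0<..A}. ennreal (h t) \<partial>lborel)"
      by (rule order_trans [rotated]) (simp add: c_def ennreal_leI)
  qed
  ultimately show thesis using that A(1) by blast
qed

subsection \<open>Borel representatives of solutions\<close>

text \<open>The preimages under f and g differ by a subset of a null set, which is measurable by
  completeness.\<close>

lemma (in complete_measure) measurable_cong_AE:
  assumes g: "g \<in> measurable M N" and f: "f \<in> space M \<rightarrow> space N" and eq: "AE x in M. f x = g x"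
  shows "f \<in> measurable M N"
proof (rule measurableI)
  fix A assume A: "A \<in> sets N"
  show "f -` A \<inter> space M \<in> sets M"
  proof (rule in_sets_AE)
    show "g -` A \<inter> space M \<in> sets M" using g A by (rule measurable_sets)
    show "AE x in M. (x \<in> g -` A \<inter> space M) = (x \<in> f -` A \<inter> space M)"
      using eq by eventually_elim auto
  qed simp
qed (use f in auto)

lemma radon_measure_sigma_finite:
  fixes \<mu> :: "'a::euclidean_space measure"
  assumes "radon_measure \<mu>"
  shows "sigma_finite_measure \<mu>"
proof
  have s: "sets \<mu> = sets borel" using assms by (simp add: radon_measure_def)
  show "\<exists>A. countable A \<and> A \<subseteq> sets \<mu> \<and> \<Union> A = space \<mu> \<and> (\<forall>a\<in>A. emeasure \<mu> a \<noteq> \<infinity>)"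
  proof (intro exI conjI ballI)
    show "countable (range (\<lambda>n. cball (0::'a) (real n)))" by simp
    show "range (\<lambda>n. cball (0::'a) (real n)) \<subseteq> sets \<mu>" unfolding s by auto
    have "\<exists>n. norm x \<le> real n" for x :: 'a by (rule real_arch_simple)
    then show "\<Union> (range (\<lambda>n. cball (0::'a) (real n))) = space \<mu>"
      unfolding sets_eq_imp_space_eq [OF s] by auto
    show "emeasure \<mu> a \<noteq> \<infinity>" if "a \<in> range (\<lambda>n. cball (0::'a) (real n))" for a
      using that assms by (auto simp: radon_measure_def less_top)
  qed
qed

text \<open>Replaces a Lebesgue measurable source by a Borel one. F is Lebesgue measurable because
  it agrees almost everywhere with F', so the density can be unfolded, and the integral over the
  completion equals the one over \<open>lborel\<close>.\<close>

lemma heat_density_lebesgue: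
  fixes F :: "'a::euclidean_space \<Rightarrow> ennreal"
  assumes F' [measurable]: "F' \<in> borel_measurable borel" and eq: "AE y in lborel. F y = F' y"
  shows "heat t (density lebesgue F) x = (\<integral>\<^sup>+y. ennreal (heat_kernel t (x - y)) * F' y \<partial>lborel)"
proof -
  have F'': "F' \<in> borel_measurable lebesgue" by (rule measurable_completion) simp
  have F: "F \<in> borel_measurable lebesgue"
    by (rule completion.measurable_cong_AE [OF F'']) (auto intro: AE_completion eq)
  have G: "(\<lambda>y. ennreal (heat_kernel t (x - y))) \<in> borel_measurable lebesgue"
    by (rule measurable_completion) simp
  have "heat t (density lebesgue F) x = (\<integral>\<^sup>+y. F y * ennreal (heat_kernel t (x - y)) \<partial>lebesgue)"
    unfolding heat_def by (rule nn_integral_density [OF F G])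
  also have "\<dots> = (\<integral>\<^sup>+y. F y * ennreal (heat_kernel t (x - y)) \<partial>lborel)"
    by (rule nn_integral_completion)
  also have "\<dots> = (\<integral>\<^sup>+y. ennreal (heat_kernel t (x - y)) * F' y \<partial>lborel)"
    using eq by (intro nn_integral_cong_AE) (auto simp: mult.commute)
  finally show ?thesis .
qed

text \<open>The integral equation for a jointly Borel representative, so that Tonelli applies to all
  iterated integrals. The exceptional null set is put into iterated form, and \<open>k\<close> is
  the density cut off to (0, infinity).\<close>

locale borel_solution =
  fixes \<alpha> :: real and h :: "real \<Rightarrow> real" and p T :: real
    and \<mu> :: "'a::euclidean_space measure" and v :: "real \<times> 'a \<Rightarrow> ennreal" and k :: "real \<Rightarrow> ennreal"
  defines "k \<equiv> \<lambda>\<theta>. ennreal (h \<theta>) * indicator {0<..} \<theta>"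
  assumes \<alpha>: "0 < \<alpha>" "\<alpha> < 1" and h: "is_h_density \<alpha> h" and p: "1 < p"
    and radon: "radon_measure \<mu>"
    and v_measurable [measurable]: "v \<in> borel_measurable (borel \<Otimes>\<^sub>M borel)"
    and v_eq: "AE t in lborel. AE x in lborel. 0 < t \<and> t < T \<longrightarrow> v (t, x) < \<infinity> \<and>
      v (t, x) = (\<integral>\<^sup>+\<theta>. k \<theta> * (\<integral>\<^sup>+y. ennreal (heat_kernel (t powr \<alpha> * \<theta>) (x - y)) \<partial>\<mu>) \<partial>lborel) +
        ennreal \<alpha> * (\<integral>\<^sup>+s\<in>{0<..<t}. ennreal ((t - s) powr (\<alpha> - 1)) *
          (\<integral>\<^sup>+\<theta>. ennreal \<theta> * k \<theta> * (\<integral>\<^sup>+y. ennreal (heat_kernel ((t - s) powr \<alpha> * \<theta>) (x - y)) *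
              ennreal_powr (v (s, y)) p \<partial>lborel) \<partial>lborel) \<partial>lborel)"

lemma is_solution_borel_solution:
  fixes \<mu> :: "'a::euclidean_space measure"
  assumes sol: "is_solution \<alpha> h p \<mu> (ereal T) u"
    and *: "0 < \<alpha>" "\<alpha> < 1" "is_h_density \<alpha> h" "1 < p" "radon_measure \<mu>"
  obtains v where "borel_solution \<alpha> h p T \<mu> v"
proof -
  define D where "D = {t. 0 < t \<and> ereal t < ereal T} \<times> (UNIV :: 'a set)"
  have "open D" unfolding D_def
    by (intro open_Times open_Collect_conj) (auto simp: open_Collect_less)
  then have "D \<inter> space lebesgue \<in> sets lebesgue" by (simp add: lebesgue_openin)
  moreover have "(\<lambda>(t, x). u t x) \<in> borel_measurable (lebesgue_on D)"
    using sol by (simp add: is_solution_def D_def)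
  ultimately have "(\<lambda>z. if z \<in> D then case z of (t, x) \<Rightarrow> u t x else 0) \<in> borel_measurable lebesgue"
    using measurable_restrict_space_iff [of D lebesgue 0 borel "\<lambda>(t, x). u t x"] by simp
  from completion_ex_borel_measurable [OF this]
  obtain v where v: "v \<in> borel_measurable lborel"
    and v_ae: "AE z in lborel. (if z \<in> D then case z of (t, x) \<Rightarrow> u t x else 0) = v z" by blast
  have [measurable]: "v \<in> borel_measurable (borel \<Otimes>\<^sub>M borel)"
    using v by (simp add: borel_prod)
  have AE_pair: "AE t in lborel. AE x in lborel. Q (t, x)"
    if "AE z in lborel. Q z" for Q :: "real \<times> 'a \<Rightarrow> bool"
    using that unfolding lborel_prod [symmetric] by (rule lborel_pair.AE_pair)
  have "AE s in lborel. AE y in lborel. (if (s, y) \<in> D then u s y else 0) = v (s, y)"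
    using AE_pair [OF v_ae] by (simp only: prod.case)
  \<comment> \<open>A null set of space-time has null slices at almost every time.\<close>
  then have uv: "AE s in lborel. 0 < s \<and> s < T \<longrightarrow> (AE y in lborel. u s y = v (s, y))"
    by eventually_elim (auto simp: D_def)
  have sol': "AE (t, x) in lborel. 0 < t \<and> ereal t < ereal T \<longrightarrow>
        u t x < \<infinity> \<and>
        u t x = P_op \<alpha> h t \<mu> x +
          ennreal \<alpha> * (\<integral>\<^sup>+s\<in>{0<..<t}. ennreal ((t - s) powr (\<alpha> - 1)) *
             S_op \<alpha> h (t - s) (density lebesgue (\<lambda>y. ennreal_powr (u s y) p)) x \<partial>lborel)"
    using sol unfolding is_solution_def AE_completion_iff by blast
  have "borel_solution \<alpha> h p T \<mu> v"
  proof
    define k where "k = (\<lambda>\<theta>. ennreal (h \<theta>) * indicator {0<..} \<theta>)"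
    show "AE t in lborel. AE x in lborel. 0 < t \<and> t < T \<longrightarrow> v (t, x) < \<infinity> \<and>
      v (t, x) = (\<integral>\<^sup>+\<theta>. k \<theta> * (\<integral>\<^sup>+y. ennreal (heat_kernel (t powr \<alpha> * \<theta>) (x - y)) \<partial>\<mu>) \<partial>lborel) +
        ennreal \<alpha> * (\<integral>\<^sup>+s\<in>{0<..<t}. ennreal ((t - s) powr (\<alpha> - 1)) *
          (\<integral>\<^sup>+\<theta>. ennreal \<theta> * k \<theta> * (\<integral>\<^sup>+y. ennreal (heat_kernel ((t - s) powr \<alpha> * \<theta>) (x - y)) *
              ennreal_powr (v (s, y)) p \<partial>lborel) \<partial>lborel) \<partial>lborel)"
      using AE_pair [OF sol'] uv
    proof eventually_elim
      case (elim t)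
      show ?case
      proof (cases "0 < t \<and> t < T")
        case True
        then have "AE x in lborel. u t x = v (t, x)" using elim by simp
        with elim(1) show ?thesis
        proof eventually_elim
          case (elim x)
          have "P_op \<alpha> h t \<mu> x = (\<integral>\<^sup>+\<theta>. k \<theta> * (\<integral>\<^sup>+y. ennreal (heat_kernel (t powr \<alpha> * \<theta>) (x - y)) \<partial>\<mu>) \<partial>lborel)"
            unfolding P_op_def heat_def k_def by (intro nn_integral_cong) (simp add: mult_ac)
          moreover have "(\<integral>\<^sup>+s\<in>{0<..<t}. ennreal ((t - s) powr (\<alpha> - 1)) *
             S_op \<alpha> h (t - s) (density lebesgue (\<lambda>y. ennreal_powr (u s y) p)) x \<partial>lborel) =
            (\<integral>\<^sup>+s\<in>{0<..<t}. ennreal ((t - s) powr (\<alpha> - 1)) *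
              (\<integral>\<^sup>+\<theta>. ennreal \<theta> * k \<theta> * (\<integral>\<^sup>+y. ennreal (heat_kernel ((t - s) powr \<alpha> * \<theta>) (x - y)) *
                ennreal_powr (v (s, y)) p \<partial>lborel) \<partial>lborel) \<partial>lborel)"
          \<comment> \<open>The times s at which u(s) and v(s, .) are not equal almost everywhere
            form a null set and do not affect the outer integral. At all other s the measure u(s)^p
            dx may be computed from v.\<close>
          proof (rule nn_integral_cong_AE)
            show "AE s in lborel. ennreal ((t - s) powr (\<alpha> - 1)) *
               S_op \<alpha> h (t - s) (density lebesgue (\<lambda>y. ennreal_powr (u s y) p)) x * indicator {0<..<t} s =
               ennreal ((t - s) powr (\<alpha> - 1)) *
              (\<integral>\<^sup>+\<theta>. ennreal \<theta> * k \<theta> * (\<integral>\<^sup>+y. ennreal (heat_kernel ((t - s) powr \<alpha> * \<theta>) (x - y)) *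
                ennreal_powr (v (s, y)) p \<partial>lborel) \<partial>lborel) * indicator {0<..<t} s"
              using uv
            proof eventually_elim
              case (elim s)
              show ?case
              proof (cases "0 < s \<and> s < t")
                case s: True
                then have "AE y in lborel. ennreal_powr (u s y) p = ennreal_powr (v (s, y)) p"
                  using elim True by auto
                then have "S_op \<alpha> h (t - s) (density lebesgue (\<lambda>y. ennreal_powr (u s y) p)) x =
                  (\<integral>\<^sup>+\<theta>. ennreal \<theta> * k \<theta> * (\<integral>\<^sup>+y. ennreal (heat_kernel ((t - s) powr \<alpha> * \<theta>) (x - y)) *
                    ennreal_powr (v (s, y)) p \<partial>lborel) \<partial>lborel)"
                  unfolding S_op_def k_def
                  by (subst heat_density_lebesgue [where F' = "\<lambda>y. ennreal_powr (v (s, y)) p"])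
                     (auto intro!: nn_integral_cong simp: indicator_def ennreal_mult' mult_ac)
                then show ?thesis by simp
              qed auto
            qed
          qed
          ultimately show ?case using elim True by auto
        qed
      qed auto
    qed
  qed (use * in auto)
  then show thesis using that by blast
qed

text \<open>Tonelli moves the x-integral inside, where the semigroup law adds the times. It serves
  the data with N = \<mu> and F = 1, and the source with Lebesgue measure and F = v(s, .)^p.
  \<open>K0\<close> confines \<theta> to positive values, for which c \<theta> is an admissible
  time.\<close>

lemma heat_kernel_smoothing:
  fixes z :: "'a::euclidean_space"
  assumes N: "sigma_finite_measure N" and sets_N [measurable_cong]: "sets N = sets borel"
    and F [measurable]: "F \<in> borel_measurable borel" and K [measurable]: "K \<in> borel_measurable borel"
    and K0: "\<And>\<theta>. \<theta> \<le> 0 \<Longrightarrow> K \<theta> = 0" and a: "0 < a" and c: "0 < c"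
  shows "(\<integral>\<^sup>+x. ennreal (heat_kernel a (x - z)) *
      (\<integral>\<^sup>+\<theta>. K \<theta> * (\<integral>\<^sup>+y. ennreal (heat_kernel (c * \<theta>) (x - y)) * F y \<partial>N) \<partial>lborel) \<partial>lborel) =
    (\<integral>\<^sup>+\<theta>. K \<theta> * (\<integral>\<^sup>+y. ennreal (heat_kernel (a + c * \<theta>) (y - z)) * F y \<partial>N) \<partial>lborel)"
proof -
  interpret N: sigma_finite_measure N by (rule N)
  interpret P: pair_sigma_finite lborel N ..
  have single: "(\<integral>\<^sup>+x. ennreal (heat_kernel a (x - z)) *
      (\<integral>\<^sup>+y. ennreal (heat_kernel b (x - y)) * F y \<partial>N) \<partial>lborel) =
      (\<integral>\<^sup>+y. ennreal (heat_kernel (a + b) (y - z)) * F y \<partial>N)" if b: "0 < b" for b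
  proof -
    have "(\<integral>\<^sup>+x. ennreal (heat_kernel a (x - z)) *
        (\<integral>\<^sup>+y. ennreal (heat_kernel b (x - y)) * F y \<partial>N) \<partial>lborel) =
        (\<integral>\<^sup>+x. \<integral>\<^sup>+y. ennreal (heat_kernel a (x - z)) * (ennreal (heat_kernel b (x - y)) * F y) \<partial>N \<partial>lborel)"
      by (subst nn_integral_cmult) simp_all
    also have "\<dots> = (\<integral>\<^sup>+y. \<integral>\<^sup>+x. ennreal (heat_kernel a (x - z)) * (ennreal (heat_kernel b (x - y)) * F y) \<partial>lborel \<partial>N)"
      by (rule P.Fubini' [symmetric]) simp
    also have "\<dots> = (\<integral>\<^sup>+y. ennreal (heat_kernel (a + b) (y - z)) * F y \<partial>N)"
      by (subst heat_kernel_semigroup [OF a b, symmetric])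
         (simp add: nn_integral_multc mult.assoc [symmetric])
    finally show ?thesis .
  qed
  have "(\<integral>\<^sup>+x. ennreal (heat_kernel a (x - z)) *
      (\<integral>\<^sup>+\<theta>. K \<theta> * (\<integral>\<^sup>+y. ennreal (heat_kernel (c * \<theta>) (x - y)) * F y \<partial>N) \<partial>lborel) \<partial>lborel) =
    (\<integral>\<^sup>+x. \<integral>\<^sup>+\<theta>. ennreal (heat_kernel a (x - z)) *
      (K \<theta> * (\<integral>\<^sup>+y. ennreal (heat_kernel (c * \<theta>) (x - y)) * F y \<partial>N)) \<partial>lborel \<partial>lborel)"
    by (subst nn_integral_cmult) simp_all
  also have "\<dots> = (\<integral>\<^sup>+\<theta>. \<integral>\<^sup>+x. ennreal (heat_kernel a (x - z)) *
      (K \<theta> * (\<integral>\<^sup>+y. ennreal (heat_kernel (c * \<theta>) (x - y)) * F y \<partial>N)) \<partial>lborel \<partial>lborel)"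
    by (rule lborel_pair.Fubini' [symmetric]) simp
  also have "\<dots> = (\<integral>\<^sup>+\<theta>. K \<theta> * (\<integral>\<^sup>+x. ennreal (heat_kernel a (x - z)) *
      (\<integral>\<^sup>+y. ennreal (heat_kernel (c * \<theta>) (x - y)) * F y \<partial>N) \<partial>lborel) \<partial>lborel)"
    by (subst nn_integral_cmult [symmetric]) (simp_all add: mult_ac)
  also have "\<dots> = (\<integral>\<^sup>+\<theta>. K \<theta> * (\<integral>\<^sup>+y. ennreal (heat_kernel (a + c * \<theta>) (y - z)) * F y \<partial>N) \<partial>lborel)"
  proof (rule nn_integral_cong)
    fix \<theta> :: real
    show "K \<theta> * (\<integral>\<^sup>+x. ennreal (heat_kernel a (x - z)) *
      (\<integral>\<^sup>+y. ennreal (heat_kernel (c * \<theta>) (x - y)) * F y \<partial>N) \<partial>lborel) =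
      K \<theta> * (\<integral>\<^sup>+y. ennreal (heat_kernel (a + c * \<theta>) (y - z)) * F y \<partial>N)"
      using single [of "c * \<theta>"] c K0 [of \<theta>] by (cases "\<theta> \<le> 0") auto
  qed
  finally show ?thesis .
qed

subsection \<open>Testing the equation with a Gaussian\<close>

lemma AE_lborel_interval_ex:
  fixes a b :: real
  assumes P: "AE x in lborel. P x" and ab: "a < b"
  obtains x where "a < x" "x < b" "P x"
proof -
  have "\<exists>x. a < x \<and> x < b \<and> P x"
  proof (rule ccontr)
    assume "\<not> (\<exists>x. a < x \<and> x < b \<and> P x)"
    then have "AE x in lborel. x \<notin> {a<..<b}" using P by (auto elim!: eventually_mono)
    then have "emeasure lborel {a<..<b} = 0" by (subst (asm) AE_iff_measurable [of "{a<..<b}"]) auto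
    then show False using ab by simp
  qed
  then show thesis using that by blast
qed

context borel_solution
begin

lemma k_eq: "k = (\<lambda>\<theta>. ennreal (indicator {0<..} \<theta> * h \<theta>))"
  by (auto simp: k_def indicator_def)

lemma k_measurable [measurable]: "k \<in> borel_measurable borel"
  unfolding k_eq using h_density_measurable [OF h] by measurable

lemma k_nonpos: "\<theta> \<le> 0 \<Longrightarrow> k \<theta> = 0"
  by (simp add: k_def)

lemma k_pos: "0 < \<theta> \<Longrightarrow> 0 < k \<theta>"
  using h_density_pos [OF h] by (simp add: k_def)

lemma sets_mu [measurable_cong]: "sets \<mu> = sets borel"
  using radon by (simp add: radon_measure_def)

text \<open>The Gaussian average of the solution; the function w of the outline is this multiplied
  by t^(\<alpha>N/2).\<close>

definition H :: "'a \<Rightarrow> real \<Rightarrow> ennreal" where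
  "H z t = (\<integral>\<^sup>+x. ennreal (heat_kernel (t powr \<alpha>) (x - z)) * v (t, x) \<partial>lborel)"

lemma H_measurable [measurable]: "H z \<in> borel_measurable borel"
  unfolding H_def by measurable

text \<open>Multiply the equation by the Gaussian and integrate in x. Since all integrands are
  nonnegative, the x-integral can be moved inside, and \<open>heat_kernel_smoothing\<close>
  evaluates it for the data and for each s.\<close>

lemma H_eq:
  "AE t in lborel. 0 < t \<and> t < T \<longrightarrow> H z t =
    (\<integral>\<^sup>+\<theta>. k \<theta> * (\<integral>\<^sup>+y. ennreal (heat_kernel (t powr \<alpha> + t powr \<alpha> * \<theta>) (y - z)) \<partial>\<mu>) \<partial>lborel) +
    ennreal \<alpha> * (\<integral>\<^sup>+s\<in>{0<..<t}. ennreal ((t - s) powr (\<alpha> - 1)) *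
      (\<integral>\<^sup>+\<theta>. ennreal \<theta> * k \<theta> * (\<integral>\<^sup>+y. ennreal (heat_kernel (t powr \<alpha> + (t - s) powr \<alpha> * \<theta>) (y - z)) *
        ennreal_powr (v (s, y)) p \<partial>lborel) \<partial>lborel) \<partial>lborel)"
  using v_eq
proof eventually_elim
  case (elim t)
  show ?case
  proof
    assume t: "0 < t \<and> t < T"
    interpret \<mu>: sigma_finite_measure \<mu> by (rule radon_measure_sigma_finite [OF radon])
    let ?G = "\<lambda>x. ennreal (heat_kernel (t powr \<alpha>) (x - z))"
    let ?P = "\<lambda>x. \<integral>\<^sup>+\<theta>. k \<theta> * (\<integral>\<^sup>+y. ennreal (heat_kernel (t powr \<alpha> * \<theta>) (x - y)) \<partial>\<mu>) \<partial>lborel"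
    let ?S = "\<lambda>s x. \<integral>\<^sup>+\<theta>. ennreal \<theta> * k \<theta> * (\<integral>\<^sup>+y. ennreal (heat_kernel ((t - s) powr \<alpha> * \<theta>) (x - y)) *
              ennreal_powr (v (s, y)) p \<partial>lborel) \<partial>lborel"
    let ?Q = "\<lambda>x. \<integral>\<^sup>+s\<in>{0<..<t}. ennreal ((t - s) powr (\<alpha> - 1)) * ?S s x \<partial>lborel"
    have "AE x in lborel. ?G x * v (t, x) = ?G x * ?P x + ennreal \<alpha> * (?G x * ?Q x)"
      using elim by eventually_elim (use t in \<open>auto simp: distrib_left mult_ac\<close>)
    then have "H z t = (\<integral>\<^sup>+x. ?G x * ?P x + ennreal \<alpha> * (?G x * ?Q x) \<partial>lborel)"
      unfolding H_def by (rule nn_integral_cong_AE)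
    also have "\<dots> = (\<integral>\<^sup>+x. ?G x * ?P x \<partial>lborel) + ennreal \<alpha> * (\<integral>\<^sup>+x. ?G x * ?Q x \<partial>lborel)"
      by (simp add: nn_integral_add nn_integral_cmult)
    also have "(\<integral>\<^sup>+x. ?G x * ?P x \<partial>lborel) =
        (\<integral>\<^sup>+\<theta>. k \<theta> * (\<integral>\<^sup>+y. ennreal (heat_kernel (t powr \<alpha> + t powr \<alpha> * \<theta>) (y - z)) \<partial>\<mu>) \<partial>lborel)"
      using heat_kernel_smoothing [OF \<mu>.sigma_finite_measure_axioms sets_mu, of "\<lambda>_. 1" k
          "t powr \<alpha>" "t powr \<alpha>" z] t k_nonpos by simp
    also have "(\<integral>\<^sup>+x. ?G x * ?Q x \<partial>lborel) = (\<integral>\<^sup>+s\<in>{0<..<t}. ennreal ((t - s) powr (\<alpha> - 1)) *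
      (\<integral>\<^sup>+\<theta>. ennreal \<theta> * k \<theta> * (\<integral>\<^sup>+y. ennreal (heat_kernel (t powr \<alpha> + (t - s) powr \<alpha> * \<theta>) (y - z)) *
        ennreal_powr (v (s, y)) p \<partial>lborel) \<partial>lborel) \<partial>lborel)"
    proof -
      have "(\<integral>\<^sup>+x. ?G x * ?Q x \<partial>lborel) = (\<integral>\<^sup>+x. \<integral>\<^sup>+s. ?G x *
          (ennreal ((t - s) powr (\<alpha> - 1)) * ?S s x * indicator {0<..<t} s) \<partial>lborel \<partial>lborel)"
        by (subst nn_integral_cmult) simp_all
      also have "\<dots> = (\<integral>\<^sup>+s. \<integral>\<^sup>+x. ?G x *
          (ennreal ((t - s) powr (\<alpha> - 1)) * ?S s x * indicator {0<..<t} s) \<partial>lborel \<partial>lborel)"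
        by (rule lborel_pair.Fubini' [symmetric]) simp
      also have "\<dots> = (\<integral>\<^sup>+s. ennreal ((t - s) powr (\<alpha> - 1)) * indicator {0<..<t} s *
          (\<integral>\<^sup>+x. ?G x * ?S s x \<partial>lborel) \<partial>lborel)"
        by (subst nn_integral_cmult [symmetric]) (simp_all add: mult_ac)
      also have "\<dots> = (\<integral>\<^sup>+s\<in>{0<..<t}. ennreal ((t - s) powr (\<alpha> - 1)) *
        (\<integral>\<^sup>+\<theta>. ennreal \<theta> * k \<theta> * (\<integral>\<^sup>+y. ennreal (heat_kernel (t powr \<alpha> + (t - s) powr \<alpha> * \<theta>) (y - z)) *
          ennreal_powr (v (s, y)) p \<partial>lborel) \<partial>lborel) \<partial>lborel)"
      proof (rule nn_integral_cong)
        fix s :: real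
        show "ennreal ((t - s) powr (\<alpha> - 1)) * indicator {0<..<t} s * (\<integral>\<^sup>+x. ?G x * ?S s x \<partial>lborel) =
          ennreal ((t - s) powr (\<alpha> - 1)) *
          (\<integral>\<^sup>+\<theta>. ennreal \<theta> * k \<theta> * (\<integral>\<^sup>+y. ennreal (heat_kernel (t powr \<alpha> + (t - s) powr \<alpha> * \<theta>) (y - z)) *
          ennreal_powr (v (s, y)) p \<partial>lborel) \<partial>lborel) * indicator {0<..<t} s"
        proof (cases "s \<in> {0<..<t}")
          case True
          then have "(\<integral>\<^sup>+x. ?G x * ?S s x \<partial>lborel) =
              (\<integral>\<^sup>+\<theta>. ennreal \<theta> * k \<theta> * (\<integral>\<^sup>+y. ennreal (heat_kernel (t powr \<alpha> + (t - s) powr \<alpha> * \<theta>) (y - z)) *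
              ennreal_powr (v (s, y)) p \<partial>lborel) \<partial>lborel)"
            using t by (intro heat_kernel_smoothing)
              (auto simp: k_nonpos lborel.sigma_finite_measure_axioms)
          then show ?thesis by (simp add: mult_ac)
        qed simp
      qed
      finally show ?thesis .
    qed
    finally show "H z t =
    (\<integral>\<^sup>+\<theta>. k \<theta> * (\<integral>\<^sup>+y. ennreal (heat_kernel (t powr \<alpha> + t powr \<alpha> * \<theta>) (y - z)) \<partial>\<mu>) \<partial>lborel) +
    ennreal \<alpha> * (\<integral>\<^sup>+s\<in>{0<..<t}. ennreal ((t - s) powr (\<alpha> - 1)) *
      (\<integral>\<^sup>+\<theta>. ennreal \<theta> * k \<theta> * (\<integral>\<^sup>+y. ennreal (heat_kernel (t powr \<alpha> + (t - s) powr \<alpha> * \<theta>) (y - z)) *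
        ennreal_powr (v (s, y)) p \<partial>lborel) \<partial>lborel) \<partial>lborel)" .
  qed
qed

text \<open>Jensen's inequality for the probability measure with density
  \<open>heat_kernel (s powr \<alpha>) (y - z)\<close>.\<close>

lemma H_powr_le:
  assumes "0 < s"
  shows "ennreal_powr (H z s) p \<le>
    (\<integral>\<^sup>+y. ennreal (heat_kernel (s powr \<alpha>) (y - z)) * ennreal_powr (v (s, y)) p \<partial>lborel)"
proof -
  let ?N = "density lborel (\<lambda>y. ennreal (heat_kernel (s powr \<alpha>) (y - z)))"
  have "ennreal_powr (\<integral>\<^sup>+y. v (s, y) \<partial>?N) p \<le> (\<integral>\<^sup>+y. ennreal_powr (v (s, y)) p \<partial>?N)"
    using assms p by (intro nn_integral_jensen_powr) (auto simp: emeasure_density nn_integral_heat_kernel)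
  then show ?thesis by (simp add: H_def nn_integral_density)
qed

text \<open>Finiteness of \<open>u\<close> at a single point \<open>(t, x)\<close> suffices: for \<open>\<theta>\<close> large the kernel of
  \<open>S\<^sub>\<alpha>(t-s)\<close> at \<open>x\<close> dominates the narrower Gaussian centred at \<open>z\<close>.\<close>
lemma H_finite:
  "AE t in lborel. 0 < t \<and> t < T \<longrightarrow> (AE s in lborel. 0 < s \<and> s < t \<longrightarrow> H z s < \<infinity>)"
  using v_eq
proof eventually_elim
  case (elim t)
  show ?case
  proof
    assume t: "0 < t \<and> t < T"
    let ?S = "\<lambda>s x. \<integral>\<^sup>+\<theta>. ennreal \<theta> * k \<theta> * (\<integral>\<^sup>+y. ennreal (heat_kernel ((t - s) powr \<alpha> * \<theta>) (x - y)) *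
              ennreal_powr (v (s, y)) p \<partial>lborel) \<partial>lborel"
    let ?P = "\<lambda>x. \<integral>\<^sup>+\<theta>. k \<theta> * (\<integral>\<^sup>+y. ennreal (heat_kernel (t powr \<alpha> * \<theta>) (x - y)) \<partial>\<mu>) \<partial>lborel"
    \<comment> \<open>Lebesgue measure is not zero, so some point x satisfies the equation with a
      finite value.\<close>
    have "ae_filter (lborel :: 'a measure) \<noteq> bot"
      by (simp add: ae_filter_eq_bot_iff)
    from eventually_happens' [OF this elim] t obtain x
      where "v (t, x) < \<infinity>" "v (t, x) = ?P x +
        ennreal \<alpha> * (\<integral>\<^sup>+s\<in>{0<..<t}. ennreal ((t - s) powr (\<alpha> - 1)) * ?S s x \<partial>lborel)" by blast
    then have "(\<integral>\<^sup>+s\<in>{0<..<t}. ennreal ((t - s) powr (\<alpha> - 1)) * ?S s x \<partial>lborel) \<noteq> \<infinity>"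
      using \<alpha> by (auto simp: ennreal_mult_eq_top_iff)
    then have "AE s in lborel. ennreal ((t - s) powr (\<alpha> - 1)) * ?S s x * indicator {0<..<t} s \<noteq> \<infinity>"
      by (intro nn_integral_PInf_AE) simp_all
    then show "AE s in lborel. 0 < s \<and> s < t \<longrightarrow> H z s < \<infinity>"
    proof eventually_elim
      case (elim s)
      show ?case
      proof
        assume s: "0 < s \<and> s < t"
        then have "?S s x \<noteq> \<infinity>" using elim by (auto simp: ennreal_mult_eq_top_iff)
        then have ae: "AE \<theta> in lborel. ennreal \<theta> * k \<theta> * (\<integral>\<^sup>+y. ennreal (heat_kernel ((t - s) powr \<alpha> * \<theta>) (x - y)) *
              ennreal_powr (v (s, y)) p \<partial>lborel) \<noteq> \<infinity>"
          by (intro nn_integral_PInf_AE) simp_all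
        \<comment> \<open>Beyond this threshold the time r = (t-s)^\<alpha> \<theta> is at least 2
          s^\<alpha>, as \<open>heat_kernel_shift_lower\<close> requires.\<close>
        define \<theta>0 where "\<theta>0 = 2 * s powr \<alpha> / (t - s) powr \<alpha>"
        from AE_lborel_interval_ex [OF ae, of "\<theta>0" "\<theta>0 + 1"] obtain \<theta> where "\<theta>0 < \<theta>"
          and fin: "ennreal \<theta> * k \<theta> * (\<integral>\<^sup>+y. ennreal (heat_kernel ((t - s) powr \<alpha> * \<theta>) (x - y)) *
              ennreal_powr (v (s, y)) p \<partial>lborel) \<noteq> \<infinity>" by auto
        have "0 < \<theta>0" using s by (simp add: \<theta>0_def)
        then have \<theta>: "0 < \<theta>" using \<open>\<theta>0 < \<theta>\<close> by simp
        define r where "r = (t - s) powr \<alpha> * \<theta>"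
        have r: "2 * s powr \<alpha> \<le> r"
          using \<open>\<theta>0 < \<theta>\<close> s by (simp add: \<theta>0_def r_def field_simps)
        have "r > 0" using s \<theta> by (simp add: r_def)
        define c where "c = (s powr \<alpha> / r) powr (real DIM('a) / 2) * exp (- (norm (x - z))\<^sup>2 / (2 * r))"
        have c: "c > 0" using s \<open>r > 0\<close> by (simp add: c_def)
        have "ennreal c * (\<integral>\<^sup>+y. ennreal (heat_kernel (s powr \<alpha>) (y - z)) * ennreal_powr (v (s, y)) p \<partial>lborel) =
            (\<integral>\<^sup>+y. ennreal c * (ennreal (heat_kernel (s powr \<alpha>) (y - z)) * ennreal_powr (v (s, y)) p) \<partial>lborel)"
          by (simp add: nn_integral_cmult)
        also have "\<dots> \<le> (\<integral>\<^sup>+y. ennreal (heat_kernel r (x - y)) * ennreal_powr (v (s, y)) p \<partial>lborel)"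
        proof (rule nn_integral_mono)
          fix y
          have "c * heat_kernel (s powr \<alpha>) (y - z) \<le> heat_kernel r (x - y)"
            unfolding c_def using s r by (intro heat_kernel_shift_lower) auto
          then have "ennreal c * ennreal (heat_kernel (s powr \<alpha>) (y - z)) \<le> ennreal (heat_kernel r (x - y))"
            using c by (simp add: ennreal_mult [symmetric] heat_kernel_nonneg ennreal_leI)
          then show "ennreal c * (ennreal (heat_kernel (s powr \<alpha>) (y - z)) * ennreal_powr (v (s, y)) p)
              \<le> ennreal (heat_kernel r (x - y)) * ennreal_powr (v (s, y)) p"
            by (simp add: mult.assoc [symmetric] mult_right_mono)
        qed
        \<comment> \<open>The factor \<theta> k(\<theta>) is positive, so finiteness of the product
          forces finiteness of the spatial integral.\<close>
        also have "\<dots> < \<infinity>"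
          using fin \<theta> k_pos [OF \<theta>] by (auto simp: r_def ennreal_mult_eq_top_iff less_top)
        finally have "(\<integral>\<^sup>+y. ennreal (heat_kernel (s powr \<alpha>) (y - z)) * ennreal_powr (v (s, y)) p \<partial>lborel) < \<infinity>"
          using c by (auto simp: ennreal_mult_less_top)
        then have "ennreal_powr (H z s) p < \<infinity>"
          using H_powr_le [of s z] s by (auto intro: le_less_trans)
        then show "H z s < \<infinity>" by (auto simp: ennreal_powr_def less_top split: if_splits)
      qed
    qed
  qed
qed

text \<open>For 0 < \<theta> <= A the time \<open>\<tau>\<close> lies between s^\<alpha> and (1 + A)
  t^\<alpha>, so its Gaussian dominates that of time s^\<alpha> up to a factor \<open>\<rho>\<close>
  independent of \<theta>. Jensen then brings in the power of H, and c accounts for the mass of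
  \<theta> h on (0, A].\<close>

lemma source_lower_bound:
  assumes A: "0 < A" and c: "0 < c" "ennreal c \<le> (\<integral>\<^sup>+\<theta>\<in>{..A}. ennreal \<theta> * k \<theta> \<partial>lborel)"
    and st: "0 < s" "s < t"
  shows "ennreal (c * ((1 + A) powr (- (real DIM('a) / 2)) * (s / t) powr (\<alpha> * (real DIM('a) / 2)))) * ennreal_powr (H z s) p \<le>
    (\<integral>\<^sup>+\<theta>. ennreal \<theta> * k \<theta> * (\<integral>\<^sup>+y. ennreal (heat_kernel (t powr \<alpha> + (t - s) powr \<alpha> * \<theta>) (y - z)) *
        ennreal_powr (v (s, y)) p \<partial>lborel) \<partial>lborel)"
proof -
  define I where "I = (\<integral>\<^sup>+y. ennreal (heat_kernel (s powr \<alpha>) (y - z)) * ennreal_powr (v (s, y)) p \<partial>lborel)"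
  define \<rho> where "\<rho> = (1 + A) powr (- (real DIM('a) / 2)) * (s / t) powr (\<alpha> * (real DIM('a) / 2))"
  have \<rho>_eq: "\<rho> = (s powr \<alpha> / ((1 + A) * t powr \<alpha>)) powr (real DIM('a) / 2)"
  proof -
    have "(s powr \<alpha> / ((1 + A) * t powr \<alpha>)) powr b = (1 + A) powr (- b) * (s / t) powr (\<alpha> * b)" for b
    proof -
      have "(s powr \<alpha> / ((1 + A) * t powr \<alpha>)) powr b =
          s powr (\<alpha> * b) / ((1 + A) powr b * t powr (\<alpha> * b))"
        using A st by (simp add: powr_divide powr_mult powr_powr)
      also have "\<dots> = 1 / (1 + A) powr b * (s powr (\<alpha> * b) / t powr (\<alpha> * b))"
        by simp
      also have "\<dots> = (1 + A) powr (- b) * (s / t) powr (\<alpha> * b)"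
        using st by (simp add: powr_divide powr_minus_divide)
      finally show ?thesis .
    qed
    then show ?thesis by (simp only: \<rho>_def)
  qed
  have \<rho>_nonneg: "0 \<le> \<rho>" by (simp add: \<rho>_def)
  have lower: "ennreal \<rho> * I \<le> (\<integral>\<^sup>+y. ennreal (heat_kernel (t powr \<alpha> + (t - s) powr \<alpha> * \<theta>) (y - z)) *
        ennreal_powr (v (s, y)) p \<partial>lborel)" if \<theta>: "0 < \<theta>" "\<theta> \<le> A" for \<theta>
  proof -
    define \<tau> where "\<tau> = t powr \<alpha> + (t - s) powr \<alpha> * \<theta>"
    have "s powr \<alpha> \<le> t powr \<alpha>" "(t - s) powr \<alpha> \<le> t powr \<alpha>"
      using st \<alpha> by (auto intro!: powr_mono2)
    moreover have "(t - s) powr \<alpha> * \<theta> \<le> t powr \<alpha> * A"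
      using calculation \<theta> by (intro mult_mono) auto
    ultimately have \<tau>: "s powr \<alpha> \<le> \<tau>" "\<tau> \<le> (1 + A) * t powr \<alpha>"
      using \<theta> by (auto simp: \<tau>_def algebra_simps intro: add_increasing2)
    have "0 < s powr \<alpha>" using st by simp
    then have "0 < \<tau>" using \<tau> by linarith
    have \<rho>_le: "\<rho> * heat_kernel (s powr \<alpha>) (y - z) \<le> heat_kernel \<tau> (y - z)" for y
    proof -
      have "\<rho> \<le> (s powr \<alpha> / \<tau>) powr (real DIM('a) / 2)"
        unfolding \<rho>_eq using \<tau> \<open>0 < \<tau>\<close> A st by (intro powr_mono2 divide_left_mono) auto
      then have "\<rho> * heat_kernel (s powr \<alpha>) (y - z) \<le> (s powr \<alpha> / \<tau>) powr (real DIM('a) / 2) * heat_kernel (s powr \<alpha>) (y - z)"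
        by (intro mult_right_mono heat_kernel_nonneg)
      also have "\<dots> \<le> heat_kernel \<tau> (y - z)"
        using \<tau> st by (intro heat_kernel_lower) auto
      finally show ?thesis .
    qed
    have "ennreal \<rho> * I = (\<integral>\<^sup>+y. ennreal \<rho> * (ennreal (heat_kernel (s powr \<alpha>) (y - z)) * ennreal_powr (v (s, y)) p) \<partial>lborel)"
      by (simp add: I_def nn_integral_cmult)
    also have "\<dots> \<le> (\<integral>\<^sup>+y. ennreal (heat_kernel \<tau> (y - z)) * ennreal_powr (v (s, y)) p \<partial>lborel)"
    proof (rule nn_integral_mono)
      fix y
      have "ennreal \<rho> * ennreal (heat_kernel (s powr \<alpha>) (y - z)) \<le> ennreal (heat_kernel \<tau> (y - z))"
        using \<rho>_le [of y] \<rho>_nonneg by (simp add: ennreal_mult [symmetric] heat_kernel_nonneg ennreal_leI)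
      then show "ennreal \<rho> * (ennreal (heat_kernel (s powr \<alpha>) (y - z)) * ennreal_powr (v (s, y)) p)
          \<le> ennreal (heat_kernel \<tau> (y - z)) * ennreal_powr (v (s, y)) p"
        by (simp add: mult.assoc [symmetric] mult_right_mono)
    qed
    finally show ?thesis by (simp add: \<tau>_def)
  qed
  have "ennreal (c * \<rho>) * ennreal_powr (H z s) p \<le> ennreal (c * \<rho>) * I"
    unfolding I_def using st by (intro mult_left_mono H_powr_le) auto
  also have "\<dots> = ennreal c * (ennreal \<rho> * I)"
    using c \<rho>_nonneg by (simp add: ennreal_mult mult.assoc)
  also have "\<dots> \<le> (\<integral>\<^sup>+\<theta>\<in>{..A}. ennreal \<theta> * k \<theta> \<partial>lborel) * (ennreal \<rho> * I)"
    using c by (intro mult_right_mono) auto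
  also have "\<dots> = (\<integral>\<^sup>+\<theta>. ennreal \<theta> * k \<theta> * indicator {..A} \<theta> * (ennreal \<rho> * I) \<partial>lborel)"
    by (simp add: nn_integral_multc)
  also have "\<dots> \<le> (\<integral>\<^sup>+\<theta>. ennreal \<theta> * k \<theta> * (\<integral>\<^sup>+y. ennreal (heat_kernel (t powr \<alpha> + (t - s) powr \<alpha> * \<theta>) (y - z)) *
        ennreal_powr (v (s, y)) p \<partial>lborel) \<partial>lborel)"
  proof (rule nn_integral_mono)
    fix \<theta> :: real
    show "ennreal \<theta> * k \<theta> * indicator {..A} \<theta> * (ennreal \<rho> * I) \<le>
        ennreal \<theta> * k \<theta> * (\<integral>\<^sup>+y. ennreal (heat_kernel (t powr \<alpha> + (t - s) powr \<alpha> * \<theta>) (y - z)) *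
        ennreal_powr (v (s, y)) p \<partial>lborel)"
    proof (cases "0 < \<theta> \<and> \<theta> \<le> A")
      case True
      then show ?thesis using lower [of \<theta>] by (simp add: mult_left_mono)
    next
      case False
      then have "k \<theta> = 0 \<or> \<theta> \<notin> {..A}" using k_nonpos [of \<theta>] by auto
      then show ?thesis by auto
    qed
  qed
  finally show ?thesis by (simp add: \<rho>_def)
qed

text \<open>On the ball |y-z|^2 <= \<sigma>^2 <= 16 \<tau>, so the exponential is at least e^(-4).
  The normalising power is decreasing in time and is bounded below by its value at (1 + A)
  t^\<alpha>.\<close>

lemma data_lower_bound:
  assumes A: "0 < A" and c: "0 < c" "ennreal c \<le> (\<integral>\<^sup>+\<theta>\<in>{..A}. k \<theta> \<partial>lborel)"
    and t: "0 < t" and \<sigma>: "0 < \<sigma>" "\<sigma>\<^sup>2 \<le> 16 * t powr \<alpha>"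
  shows "ennreal (c * (4 * pi * (1 + A)) powr (- (real DIM('a) / 2)) * exp (- 4) * t powr (- (\<alpha> * (real DIM('a) / 2)))) * emeasure \<mu> (ball z \<sigma>) \<le>
    (\<integral>\<^sup>+\<theta>. k \<theta> * (\<integral>\<^sup>+y. ennreal (heat_kernel (t powr \<alpha> + t powr \<alpha> * \<theta>) (y - z)) \<partial>\<mu>) \<partial>lborel)"
proof -
  define d where "d = (4 * pi * (1 + A)) powr (- (real DIM('a) / 2)) * exp (- 4) * t powr (- (\<alpha> * (real DIM('a) / 2)))"
  have d_eq: "d = (4 * pi * ((1 + A) * t powr \<alpha>)) powr (- (real DIM('a) / 2)) * exp (- 4)"
  proof -
    have "(4 * pi * ((1 + A) * t powr \<alpha>)) powr (- (real DIM('a) / 2)) = ((4 * pi * (1 + A)) * t powr \<alpha>) powr (- (real DIM('a) / 2))"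
      by (simp add: mult.assoc)
    also have "\<dots> = (4 * pi * (1 + A)) powr (- (real DIM('a) / 2)) * t powr (- (\<alpha> * (real DIM('a) / 2)))"
      using A t by (subst powr_mult) (simp_all add: powr_powr)
    finally show ?thesis by (simp add: d_def)
  qed
  have lower: "ennreal d * emeasure \<mu> (ball z \<sigma>) \<le>
      (\<integral>\<^sup>+y. ennreal (heat_kernel (t powr \<alpha> + t powr \<alpha> * \<theta>) (y - z)) \<partial>\<mu>)" if \<theta>: "0 < \<theta>" "\<theta> \<le> A" for \<theta>
  proof -
    define \<tau> where "\<tau> = t powr \<alpha> + t powr \<alpha> * \<theta>"
    have "t powr \<alpha> * \<theta> \<le> t powr \<alpha> * A" using \<theta> by (intro mult_left_mono) auto
    then have \<tau>: "t powr \<alpha> \<le> \<tau>" "\<tau> \<le> (1 + A) * t powr \<alpha>"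
      using \<theta> by (auto simp: \<tau>_def algebra_simps)
    have "0 < t powr \<alpha>" using t by simp
    then have "0 < \<tau>" using \<tau> by linarith
    have d_le: "d \<le> heat_kernel \<tau> (y - z)" if y: "y \<in> ball z \<sigma>" for y
    proof -
      have "(norm (y - z))\<^sup>2 \<le> \<sigma>\<^sup>2"
        using y by (intro power_mono) (auto simp: dist_norm norm_minus_commute)
      also have "\<dots> \<le> 16 * \<tau>" using \<sigma> \<tau> by simp
      finally have "(norm (y - z))\<^sup>2 / (4 * \<tau>) \<le> 4" using \<open>0 < \<tau>\<close> by (simp add: field_simps)
      then have "exp (- 4) \<le> exp (- (norm (y - z))\<^sup>2 / (4 * \<tau>))" by simp
      moreover have "(4 * pi * ((1 + A) * t powr \<alpha>)) powr (- (real DIM('a) / 2)) \<le> (4 * pi * \<tau>) powr (- (real DIM('a) / 2))"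
        using \<tau> \<open>0 < \<tau>\<close> by (intro powr_mono2') auto
      ultimately show ?thesis
        unfolding d_eq heat_kernel_def by (intro mult_mono) auto
    qed
    have "ennreal d * emeasure \<mu> (ball z \<sigma>) = (\<integral>\<^sup>+y. ennreal d * indicator (ball z \<sigma>) y \<partial>\<mu>)"
      by (subst nn_integral_cmult_indicator) (auto simp: sets_mu)
    also have "\<dots> \<le> (\<integral>\<^sup>+y. ennreal (heat_kernel \<tau> (y - z)) \<partial>\<mu>)"
      using d_le by (intro nn_integral_mono) (auto simp: indicator_def intro!: ennreal_leI simp del: mem_ball)
    finally show ?thesis by (simp add: \<tau>_def)
  qed
  have "ennreal (c * d) * emeasure \<mu> (ball z \<sigma>) = ennreal c * (ennreal d * emeasure \<mu> (ball z \<sigma>))"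
    using c by (simp add: ennreal_mult mult.assoc d_def)
  also have "\<dots> \<le> (\<integral>\<^sup>+\<theta>\<in>{..A}. k \<theta> \<partial>lborel) * (ennreal d * emeasure \<mu> (ball z \<sigma>))"
    using c by (intro mult_right_mono) auto
  also have "\<dots> = (\<integral>\<^sup>+\<theta>. k \<theta> * indicator {..A} \<theta> * (ennreal d * emeasure \<mu> (ball z \<sigma>)) \<partial>lborel)"
    by (simp add: nn_integral_multc)
  also have "\<dots> \<le> (\<integral>\<^sup>+\<theta>. k \<theta> * (\<integral>\<^sup>+y. ennreal (heat_kernel (t powr \<alpha> + t powr \<alpha> * \<theta>) (y - z)) \<partial>\<mu>) \<partial>lborel)"
  proof (rule nn_integral_mono)
    fix \<theta> :: real
    show "k \<theta> * indicator {..A} \<theta> * (ennreal d * emeasure \<mu> (ball z \<sigma>)) \<le>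
        k \<theta> * (\<integral>\<^sup>+y. ennreal (heat_kernel (t powr \<alpha> + t powr \<alpha> * \<theta>) (y - z)) \<partial>\<mu>)"
    proof (cases "0 < \<theta> \<and> \<theta> \<le> A")
      case True
      then show ?thesis using lower [of \<theta>] by (simp add: mult_left_mono)
    next
      case False
      then have "k \<theta> = 0 \<or> \<theta> \<notin> {..A}" using k_nonpos [of \<theta>] by auto
      then show ?thesis by auto
    qed
  qed
  finally show ?thesis by (simp add: d_def mult.assoc)
qed

end

subsection \<open>Bounds for the initial measure\<close>

text \<open>If the inequality failed, the blow-up lemma with a = \<open>c0 * m\<close> would make w
  infinite almost everywhere on an interval ending at t1 <= T, against
  \<open>H_finite\<close>.\<close>

lemma (in borel_solution) mass_bound:
  assumes A: "0 < A" and c: "0 < c" "ennreal c \<le> (\<integral>\<^sup>+\<theta>\<in>{..A}. k \<theta> \<partial>lborel)"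
      "ennreal c \<le> (\<integral>\<^sup>+\<theta>\<in>{..A}. ennreal \<theta> * k \<theta> \<partial>lborel)"
    and t: "0 < t0" "t0 < t1" "t1 \<le> T" and \<sigma>: "0 < \<sigma>" "\<sigma>\<^sup>2 \<le> 16 * t0 powr \<alpha>"
    and m: "0 < m" "emeasure \<mu> (ball z \<sigma>) = ennreal m"
  shows "c * \<alpha> * (1 + A) powr (- (real DIM('a) / 2)) * t1 powr (\<alpha> - 1) *
      integral {t0..t1} (\<lambda>s. s powr (- (\<alpha> * (real DIM('a) / 2) * (p - 1)))) \<le>
    (c * (4 * pi * (1 + A)) powr (- (real DIM('a) / 2)) * exp (- 4) * m) powr (1 - p) / (1 - 2 powr (1 - p))"
    (is "?C * integral _ _ \<le> ?R")
proof (rule ccontr)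
  define e where "e = \<alpha> * (real DIM('a) / 2)"
  define C where "C = ?C"
  define q where "q = (1 + A) powr (- (real DIM('a) / 2))"
  define c0 where "c0 = c * (4 * pi * (1 + A)) powr (- (real DIM('a) / 2)) * exp (- 4)"
  define g where "g = (\<lambda>s::real. C * s powr (- (e * (p - 1))))"
  \<comment> \<open>The weight t^e, with e = \<alpha>N/2, cancels the t^(-e) of the data bound and
    turns the factor (s/t)^e of the source bound into s^e = s^(-e(p-1)) s^(ep). The last power is
    absorbed into w(s)^p.\<close>
  define w where "w = (\<lambda>t. ennreal (t powr e) * H z t)"
  have C: "0 \<le> C" "C = c * \<alpha> * q * t1 powr (\<alpha> - 1)" using c \<alpha> by (auto simp: C_def q_def)
  have c0: "0 < c0" using c A by (simp add: c0_def)
  have q: "0 < q" using A by (simp add: q_def)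
  assume "\<not> ?C * integral {t0..t1} (\<lambda>s. s powr (- (\<alpha> * (real DIM('a) / 2) * (p - 1)))) \<le> ?R"
  then have large: "(c0 * m) powr (1 - p) / (1 - 2 powr (1 - p)) < integral {t0..t1} g"
    by (simp add: g_def C_def e_def c0_def)
  have "AE t in lborel. t0 < t \<and> t < t1 \<longrightarrow>
      ennreal (c0 * m) + (\<integral>\<^sup>+s\<in>{t0<..<t}. ennreal (g s) * ennreal_powr (w s) p \<partial>lborel) \<le> w t"
    using H_eq [of z]
  proof eventually_elim
    case (elim t)
    show ?case
    proof
      assume t': "t0 < t \<and> t < t1"
      then have tpos: "0 < t" using t by simp
      let ?P = "\<integral>\<^sup>+\<theta>. k \<theta> * (\<integral>\<^sup>+y. ennreal (heat_kernel (t powr \<alpha> + t powr \<alpha> * \<theta>) (y - z)) \<partial>\<mu>) \<partial>lborel"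
      let ?S = "\<lambda>s. \<integral>\<^sup>+\<theta>. ennreal \<theta> * k \<theta> *
        (\<integral>\<^sup>+y. ennreal (heat_kernel (t powr \<alpha> + (t - s) powr \<alpha> * \<theta>) (y - z)) *
          ennreal_powr (v (s, y)) p \<partial>lborel) \<partial>lborel"
      let ?Q = "\<integral>\<^sup>+s\<in>{0<..<t}. ennreal ((t - s) powr (\<alpha> - 1)) * ?S s \<partial>lborel"
      have "t0 powr \<alpha> \<le> t powr \<alpha>" using t t' \<alpha> by (intro powr_mono2) auto
      then have "\<sigma>\<^sup>2 \<le> 16 * t powr \<alpha>" using \<sigma> by simp
      from data_lower_bound [OF A c(1,2) tpos \<sigma>(1) this, of z]
      have "ennreal (c0 * t powr (- e)) * ennreal m \<le> ?P"
        by (simp add: c0_def e_def m)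
      then have "ennreal (t powr e) * (ennreal (c0 * t powr (- e)) * ennreal m) \<le> ennreal (t powr e) * ?P"
        by (intro mult_left_mono) auto
      moreover have "ennreal (t powr e) * (ennreal (c0 * t powr (- e)) * ennreal m) = ennreal (c0 * m)"
        using tpos c0 m by (simp add: ennreal_mult [symmetric] powr_minus)
      ultimately have P: "ennreal (c0 * m) \<le> ennreal (t powr e) * ?P" by simp
      have "(\<integral>\<^sup>+s\<in>{t0<..<t}. ennreal (g s) * ennreal_powr (w s) p \<partial>lborel) \<le>
          (\<integral>\<^sup>+s. ennreal (t powr e * \<alpha>) * (ennreal ((t - s) powr (\<alpha> - 1)) * ?S s * indicator {0<..<t} s) \<partial>lborel)"
      proof (rule nn_integral_mono)
        fix s :: real
        show "ennreal (g s) * ennreal_powr (w s) p * indicator {t0<..<t} s \<le>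
            ennreal (t powr e * \<alpha>) * (ennreal ((t - s) powr (\<alpha> - 1)) * ?S s * indicator {0<..<t} s)"
        proof (cases "s \<in> {t0<..<t}")
          case True
          then have s: "0 < s" "s < t" using t by auto
          have "g s * s powr (e * p) \<le> t powr e * \<alpha> * (t - s) powr (\<alpha> - 1) * (c * (q * (s / t) powr e))"
          proof -
            have "g s * s powr (e * p) = C * s powr e"
              by (simp add: g_def powr_add [symmetric] algebra_simps)
            also have "\<dots> = c * \<alpha> * q * s powr e * t1 powr (\<alpha> - 1)" by (simp add: C)
            \<comment> \<open>Since 0 < t - s < t1 and \<alpha> < 1, the singular kernel is at least
              t1^(\<alpha>-1).\<close>
            also have "\<dots> \<le> c * \<alpha> * q * s powr e * (t - s) powr (\<alpha> - 1)"
              using c \<alpha> q s t t' by (intro mult_left_mono powr_mono2') auto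
            also have "\<dots> = t powr e * \<alpha> * (t - s) powr (\<alpha> - 1) * (c * (q * (s / t) powr e))"
              using s tpos by (simp add: powr_divide)
            finally show ?thesis .
          qed
          have "ennreal (g s) * ennreal_powr (w s) p = ennreal (g s * s powr (e * p)) * ennreal_powr (H z s) p"
          proof -
            have "0 \<le> g s" using C(1) by (simp add: g_def)
            then show ?thesis
              using s by (simp add: w_def ennreal_powr_cmult powr_powr ennreal_mult mult.assoc)
          qed
          also have "\<dots> \<le> ennreal (t powr e * \<alpha> * (t - s) powr (\<alpha> - 1) * (c * (q * (s / t) powr e))) * ennreal_powr (H z s) p"
            by (intro mult_right_mono ennreal_leI) (fact, simp)
          also have "\<dots> = ennreal (t powr e * \<alpha>) * (ennreal ((t - s) powr (\<alpha> - 1)) *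
              (ennreal (c * (q * (s / t) powr e)) * ennreal_powr (H z s) p))"
            using \<alpha> c q by (simp add: ennreal_mult mult.assoc)
          also have "\<dots> \<le> ennreal (t powr e * \<alpha>) * (ennreal ((t - s) powr (\<alpha> - 1)) * ?S s)"
            using source_lower_bound [OF A c(1,3) s, of z]
            by (intro mult_left_mono) (auto simp: e_def q_def)
          finally show ?thesis using s True by simp
        qed simp
      qed
      also have "\<dots> = ennreal (t powr e) * (ennreal \<alpha> * ?Q)"
        using \<alpha> by (subst nn_integral_cmult) (simp_all add: ennreal_mult mult.assoc)
      finally have "ennreal (c0 * m) + (\<integral>\<^sup>+s\<in>{t0<..<t}. ennreal (g s) * ennreal_powr (w s) p \<partial>lborel) \<le>
          ennreal (t powr e) * ?P + ennreal (t powr e) * (ennreal \<alpha> * ?Q)"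
        using P by (intro add_mono)
      also have "\<dots> = w t"
        using elim tpos t t' by (simp add: w_def distrib_left)
      finally show "ennreal (c0 * m) + (\<integral>\<^sup>+s\<in>{t0<..<t}. ennreal (g s) * ennreal_powr (w s) p \<partial>lborel) \<le> w t" .
    qed
  qed
  moreover have "w \<in> borel_measurable borel" "g \<in> borel_measurable borel"
    by (simp_all add: w_def g_def)
  moreover have "continuous_on {t0..t1} g"
    unfolding g_def using t by (intro continuous_intros) auto
  moreover have "0 \<le> g s" for s using C by (simp add: g_def)
  ultimately obtain t2 where t2: "t0 \<le> t2" "t2 < t1"
      and inf: "AE t in lborel. t2 < t \<and> t < t1 \<longrightarrow> w t = \<infinity>"
    using superlinear_integral_inequality_blowup [of w g t0 t1 "c0 * m" p] t(2) c0 m p large by auto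
  \<comment> \<open>\<open>H_finite\<close> gives finiteness only before a suitable time t. Hence t
    is chosen first in (t2, t1), and then s in (t2, t), where w is infinite while H is
    finite.\<close>
  obtain t where tt: "t2 < t" "t < t1" and "0 < t \<and> t < T \<longrightarrow> (AE s in lborel. 0 < s \<and> s < t \<longrightarrow> H z s < \<infinity>)"
    using AE_lborel_interval_ex [OF H_finite [of z] t2(2)] by blast
  then have "AE s in lborel. 0 < s \<and> s < t \<longrightarrow> H z s < \<infinity>" using t t2 by simp
  with inf have "AE s in lborel. (t2 < s \<and> s < t1 \<longrightarrow> w s = \<infinity>) \<and> (0 < s \<and> s < t \<longrightarrow> H z s < \<infinity>)"
    by eventually_elim auto
  then obtain s where "t2 < s" "s < t"
      "(t2 < s \<and> s < t1 \<longrightarrow> w s = \<infinity>) \<and> (0 < s \<and> s < t \<longrightarrow> H z s < \<infinity>)"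
    using AE_lborel_interval_ex tt(1) by blast
  then have "w s = \<infinity>" "H z s < \<infinity>" using t t2 tt by auto
  then show False by (simp add: w_def ennreal_mult_eq_top_iff)
qed

text \<open>Multiplying \<open>mass_bound\<close> by m^(p-1) isolates the mass. K is fixed before
  \<alpha>, h, T and \<mu>, since A and c serve all orders in [a0, 1).\<close>

lemma solution_ball_bound:
  fixes a0 p :: real
  assumes a0: "0 < a0" and p: "1 < p"
  obtains K where "0 < K"
    "\<And>\<alpha> h T (\<mu> :: 'a::euclidean_space measure) u z \<sigma> t0 t1. a0 \<le> \<alpha> \<Longrightarrow> \<alpha> < 1 \<Longrightarrow> is_h_density \<alpha> h \<Longrightarrow>
      radon_measure \<mu> \<Longrightarrow> is_solution \<alpha> h p \<mu> (ereal T) u \<Longrightarrow> 0 < t0 \<Longrightarrow> t0 < t1 \<Longrightarrow> t1 \<le> T \<Longrightarrow>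
      0 < \<sigma> \<Longrightarrow> \<sigma>\<^sup>2 \<le> 16 * t0 powr \<alpha> \<Longrightarrow>
      measure \<mu> (ball z \<sigma>) powr (p - 1) * (t1 powr (\<alpha> - 1) *
        integral {t0..t1} (\<lambda>s. s powr (- (\<alpha> * (real DIM('a) / 2) * (p - 1))))) \<le> K"
proof -
  obtain A c where A: "0 < A" and c: "0 < c"
    and mass: "\<And>\<alpha> h. a0 \<le> \<alpha> \<Longrightarrow> \<alpha> < 1 \<Longrightarrow> is_h_density \<alpha> h \<Longrightarrow>
      ennreal c \<le> (\<integral>\<^sup>+t\<in>{0<..A}. ennreal (h t) \<partial>lborel) \<and>
      ennreal c \<le> (\<integral>\<^sup>+t\<in>{0<..A}. ennreal (t * h t) \<partial>lborel)"
    using h_density_mass_bound [OF a0] by metis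
  define q where "q = (1 + A) powr (- (real DIM('a) / 2))"
  define c0 where "c0 = c * (4 * pi * (1 + A)) powr (- (real DIM('a) / 2)) * exp (- 4)"
  define l :: real where "l = 1 - 2 powr (1 - p)"
  have l: "0 < l" using p by (simp add: l_def powr_less_one)
  have pos: "0 < q" "0 < c0" using A c by (auto simp: q_def c0_def)
  define K where "K = c0 powr (1 - p) / (l * (c * a0 * q))"
  have K: "0 < K" using a0 c pos l by (simp add: K_def)
  moreover have "measure \<mu> (ball z \<sigma>) powr (p - 1) * (t1 powr (\<alpha> - 1) *
        integral {t0..t1} (\<lambda>s. s powr (- (\<alpha> * (real DIM('a) / 2) * (p - 1))))) \<le> K"
    if \<alpha>: "a0 \<le> \<alpha>" "\<alpha> < 1" and h: "is_h_density \<alpha> h" and radon: "radon_measure \<mu>"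
      and sol: "is_solution \<alpha> h p \<mu> (ereal T) u" and t: "0 < t0" "t0 < t1" "t1 \<le> T"
      and \<sigma>: "0 < \<sigma>" "\<sigma>\<^sup>2 \<le> 16 * t0 powr \<alpha>"
    for \<alpha> h T and \<mu> :: "'a measure" and u z \<sigma> t0 t1
  proof -
    define m where "m = measure \<mu> (ball z \<sigma>)"
    define X where "X = t1 powr (\<alpha> - 1) * integral {t0..t1} (\<lambda>s. s powr (- (\<alpha> * (real DIM('a) / 2) * (p - 1))))"
    have "continuous_on {t0..t1} (\<lambda>s. s powr (- (\<alpha> * (real DIM('a) / 2) * (p - 1))))"
      using t by (intro continuous_intros) auto
    then have X: "0 \<le> X"
      by (auto simp: X_def intro!: mult_nonneg_nonneg integral_nonneg integrable_continuous_real)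
    have "emeasure \<mu> (ball z \<sigma>) \<le> emeasure \<mu> (cball z \<sigma>)"
      using radon by (intro emeasure_mono) (auto simp: radon_measure_def)
    also have "\<dots> < \<infinity>" using radon by (auto simp: radon_measure_def)
    finally have em: "emeasure \<mu> (ball z \<sigma>) = ennreal m"
      by (simp add: m_def emeasure_eq_ennreal_measure less_top)
    show ?thesis
    proof (cases "m = 0")
      \<comment> \<open>The blow-up argument requires m > 0; for m = 0 the left-hand side vanishes
        because \<open>0 powr (p - 1)\<close> is 0.\<close>
      case True
      then show ?thesis using K by (simp add: m_def)
    next
      case False
      then have m: "0 < m" by (simp add: m_def zero_less_measure_iff)
      obtain v where v: "borel_solution \<alpha> h p T \<mu> v"
        using is_solution_borel_solution [OF sol _ \<alpha>(2) h p radon] \<alpha> a0 by auto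
      have "ennreal c \<le> (\<integral>\<^sup>+\<theta>\<in>{..A}. ennreal (h \<theta>) * indicator {0<..} \<theta> \<partial>lborel)"
        using mass [OF \<alpha> h, THEN conjunct1] by (auto elim!: order_trans intro!: nn_integral_mono simp: indicator_def)
      moreover have "ennreal c \<le> (\<integral>\<^sup>+\<theta>\<in>{..A}. ennreal \<theta> * (ennreal (h \<theta>) * indicator {0<..} \<theta>) \<partial>lborel)"
        using mass [OF \<alpha> h, THEN conjunct2] by (auto elim!: order_trans intro!: nn_integral_mono simp: indicator_def ennreal_mult')
      ultimately have "c * \<alpha> * q * X \<le> (c0 * m) powr (1 - p) / l"
        using borel_solution.mass_bound [OF v A c _ _ t \<sigma> m em] by (simp add: q_def c0_def X_def l_def mult.assoc)
      \<comment> \<open>Replacing the prefactor \<alpha> by a0 makes the constant uniform in the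
        order.\<close>
      moreover have "c * a0 * q * X \<le> c * \<alpha> * q * X"
        using c \<alpha> pos X by (intro mult_right_mono mult_left_mono) auto
      ultimately have "m powr (p - 1) * (c * a0 * q * X) \<le> m powr (p - 1) * ((c0 * m) powr (1 - p) / l)"
        by (intro mult_left_mono) auto
      also have "\<dots> = c0 powr (1 - p) / l"
        using m pos by (simp add: powr_mult powr_add [symmetric])
      finally have "(c * a0 * q) * (m powr (p - 1) * X) \<le> c0 powr (1 - p) / l" by (simp add: mult_ac)
      then have "m powr (p - 1) * X \<le> K"
        using c a0 pos l by (simp add: K_def field_simps)
      then show ?thesis by (simp add: m_def X_def)
    qed
  qed
  ultimately show thesis using that by blast
qed

text \<open>Taking a0 = min(\<alpha>, 1/2) admits every order, and yields a function of \<alpha>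
  that is constant on [1/2, 1). Its upper limit at 1 is then the positive number K(1/2).\<close>

lemma uniform_constant_choice:
  fixes Q :: "real \<Rightarrow> real \<Rightarrow> bool"
  assumes "\<And>a0. 0 < a0 \<Longrightarrow> \<exists>K>0. \<forall>\<alpha>. a0 \<le> \<alpha> \<and> \<alpha> < 1 \<longrightarrow> Q \<alpha> K"
  shows "\<exists>\<gamma>. (\<forall>\<alpha>\<in>{0<..<1}. 0 < \<gamma> \<alpha>) \<and> 0 < Limsup (at_left 1) (\<lambda>\<alpha>. ereal (\<gamma> \<alpha>)) \<and>
    Limsup (at_left 1) (\<lambda>\<alpha>. ereal (\<gamma> \<alpha>)) < \<infinity> \<and> (\<forall>\<alpha>\<in>{0<..<1}. Q \<alpha> (\<gamma> \<alpha>))"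
proof -
  obtain K where K: "\<And>a0. 0 < a0 \<Longrightarrow> 0 < K a0" "\<And>a0 \<alpha>. 0 < a0 \<Longrightarrow> a0 \<le> \<alpha> \<Longrightarrow> \<alpha> < 1 \<Longrightarrow> Q \<alpha> (K a0)"
    using assms by metis
  define \<gamma> where "\<gamma> = (\<lambda>\<alpha>::real. K (min \<alpha> (1 / 2)))"
  have "\<forall>\<^sub>F \<alpha>::real in at_left 1. 1 / 2 < \<alpha> \<and> \<alpha> < 1"
    using eventually_at_left_real [of "1 / 2" "1::real"] by simp
  then have "\<forall>\<^sub>F \<alpha> in at_left 1. ereal (\<gamma> \<alpha>) = ereal (K (1 / 2))"
    by eventually_elim (simp add: \<gamma>_def)
  then have "Limsup (at_left 1) (\<lambda>\<alpha>. ereal (\<gamma> \<alpha>)) = Limsup (at_left (1::real)) (\<lambda>_. ereal (K (1 / 2)))"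
    by (rule Limsup_eq)
  also have "\<dots> = ereal (K (1 / 2))" by (rule Limsup_const) simp
  finally show ?thesis
    using K by (intro exI [of _ \<gamma>]) (auto simp: \<gamma>_def)
qed

section \<open>The two choices of the time interval\<close>

lemma powr_le_imp_le_powr:
  fixes m r x :: real
  assumes "0 < r" "0 \<le> m" "m powr r \<le> x"
  shows "m \<le> x powr (1 / r)"
proof -
  have "m = (m powr r) powr (1 / r)" using assms by (simp add: powr_powr)
  also have "\<dots> \<le> x powr (1 / r)" using assms by (intro powr_mono2) auto
  finally show ?thesis .
qed

lemma integral_powr_minus:
  fixes a b \<alpha> :: real
  assumes "0 < a" "a \<le> b" "\<alpha> < 1"
  shows "integral {a..b} (\<lambda>t. t powr (- \<alpha>)) = (b powr (1 - \<alpha>) - a powr (1 - \<alpha>)) / (1 - \<alpha>)"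
proof -
  have "((\<lambda>t. t powr (- \<alpha>)) has_integral (b powr (1 - \<alpha>) / (1 - \<alpha>) - a powr (1 - \<alpha>) / (1 - \<alpha>))) {a..b}"
    using assms
    by (intro fundamental_theorem_of_calculus)
       (auto intro!: derivative_eq_intros simp: has_real_derivative_iff_has_vector_derivative [symmetric])
  then show ?thesis by (simp add: integral_unique diff_divide_distrib)
qed

text \<open>Shows that the starting time t0 = \<sigma>^(2/\<alpha>) / 16 is admissible in
  \<open>solution_ball_bound\<close>: t0^\<alpha> equals \<sigma>^2 / 16^\<alpha>, and 16^\<alpha>
  <= 16.\<close>

lemma square_le_powr:
  fixes \<sigma> \<alpha> :: real
  assumes "0 < \<alpha>" "\<alpha> \<le> 1" "0 < \<sigma>"
  shows "\<sigma>\<^sup>2 \<le> 16 * (\<sigma> powr (2 / \<alpha>) / 16) powr \<alpha>"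
proof -
  have "(16::real) powr \<alpha> \<le> 16 powr 1" using assms by (intro powr_mono) auto
  then have "\<sigma>\<^sup>2 * 16 powr \<alpha> \<le> \<sigma>\<^sup>2 * 16" by (intro mult_left_mono) auto
  moreover have "(\<sigma> powr (2 / \<alpha>) / 16) powr \<alpha> = \<sigma>\<^sup>2 / 16 powr \<alpha>"
    using assms by (simp add: powr_divide powr_powr)
  ultimately show ?thesis by (simp add: pos_le_divide_eq)
qed

text \<open>Use the interval from t1/16 to t1 = \<sigma>^(2/\<alpha>). All its times are comparable,
  so the integral is at least a multiple of t1^(1-b), and the (p-1)-th root gives the power of
  \<sigma>.\<close>

lemma parabolic_scale_bound:
  fixes a0 p :: real
  assumes a0: "0 < a0" and p: "1 < p"
  obtains K where "0 < K"
    "\<And>\<alpha> h T (\<mu> :: 'a::euclidean_space measure) u z \<sigma>. a0 \<le> \<alpha> \<Longrightarrow> \<alpha> < 1 \<Longrightarrow> is_h_density \<alpha> h \<Longrightarrow>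
      radon_measure \<mu> \<Longrightarrow> is_solution \<alpha> h p \<mu> (ereal T) u \<Longrightarrow> 0 < \<sigma> \<Longrightarrow> \<sigma> powr (2 / \<alpha>) \<le> T \<Longrightarrow>
      measure \<mu> (ball z \<sigma>) \<le> K * \<sigma> powr (real DIM('a) - 2 / (p - 1))"
proof -
  obtain K where K: "0 < K" and bound: "\<And>\<alpha> h T (\<mu> :: 'a measure) u z \<sigma> t0 t1. a0 \<le> \<alpha> \<Longrightarrow> \<alpha> < 1 \<Longrightarrow>
      is_h_density \<alpha> h \<Longrightarrow> radon_measure \<mu> \<Longrightarrow> is_solution \<alpha> h p \<mu> (ereal T) u \<Longrightarrow> 0 < t0 \<Longrightarrow> t0 < t1 \<Longrightarrow> t1 \<le> T \<Longrightarrow>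
      0 < \<sigma> \<Longrightarrow> \<sigma>\<^sup>2 \<le> 16 * t0 powr \<alpha> \<Longrightarrow>
      measure \<mu> (ball z \<sigma>) powr (p - 1) * (t1 powr (\<alpha> - 1) *
        integral {t0..t1} (\<lambda>s. s powr (- (\<alpha> * (real DIM('a) / 2) * (p - 1))))) \<le> K"
    using solution_ball_bound [OF a0 p, where 'a = 'a] by metis
  \<comment> \<open>The factor 16/15 compensates for the length 15/16 t1 of the interval.\<close>
  define L where "L = (16 / 15 * K) powr (1 / (p - 1))"
  have "0 < L" using K by (simp add: L_def)
  moreover have "measure \<mu> (ball z \<sigma>) \<le> L * \<sigma> powr (real DIM('a) - 2 / (p - 1))"
    if \<alpha>: "a0 \<le> \<alpha>" "\<alpha> < 1" and *: "is_h_density \<alpha> h" "radon_measure \<mu>" "is_solution \<alpha> h p \<mu> (ereal T) u"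
      and \<sigma>: "0 < \<sigma>" "\<sigma> powr (2 / \<alpha>) \<le> T"
    for \<alpha> h T and \<mu> :: "'a measure" and u z \<sigma>
  proof -
    define t1 where "t1 = \<sigma> powr (2 / \<alpha>)"
    define m where "m = measure \<mu> (ball z \<sigma>)"
    define b where "b = \<alpha> * (real DIM('a) / 2) * (p - 1)"
    have \<alpha>0: "0 < \<alpha>" using \<alpha> a0 by simp
    have t1: "0 < t1" using \<sigma> by (simp add: t1_def)
    have b: "0 \<le> b" using \<alpha>0 p by (simp add: b_def)
    have "\<sigma>\<^sup>2 \<le> 16 * (t1 / 16) powr \<alpha>"
      unfolding t1_def using \<alpha> \<alpha>0 \<sigma> by (intro square_le_powr) auto
    from bound [OF \<alpha> *, of "t1 / 16" t1, OF _ _ _ \<sigma>(1) this] t1 \<sigma>(2)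
    have "m powr (p - 1) * (t1 powr (\<alpha> - 1) * integral {t1 / 16..t1} (\<lambda>s. s powr (- b))) \<le> K"
      by (simp add: t1_def m_def b_def)
    moreover have "15 / 16 * t1 * t1 powr (- b) \<le> integral {t1 / 16..t1} (\<lambda>s. s powr (- b))"
    proof -
      have "integral {t1 / 16..t1} (\<lambda>_. t1 powr (- b)) \<le> integral {t1 / 16..t1} (\<lambda>s. s powr (- b))"
      proof (rule integral_le)
        show "(\<lambda>s. s powr (- b)) integrable_on {t1 / 16..t1}"
          using t1 by (intro integrable_continuous_real continuous_intros) auto
        show "t1 powr (- b) \<le> s powr (- b)" if "s \<in> {t1 / 16..t1}" for s
          using that t1 b by (intro powr_mono2') auto
      qed auto
      then show ?thesis using t1 by simp
    qed
    ultimately have "m powr (p - 1) * (t1 powr (\<alpha> - 1) * (15 / 16 * t1 * t1 powr (- b))) \<le> K"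
      by (meson mult_left_mono order_trans powr_ge_zero)
    also have "t1 powr (\<alpha> - 1) * (15 / 16 * t1 * t1 powr (- b)) = 15 / 16 * (t1 powr (\<alpha> - 1 + 1 - b))"
      unfolding powr_diff powr_add using t1 by (simp add: powr_minus_divide)
    \<comment> \<open>The order cancels here: t1^(\<alpha>-b) = \<sigma>^(2(\<alpha>-b)/\<alpha>),
      and b is proportional to \<alpha>.\<close>
    also have "t1 powr (\<alpha> - 1 + 1 - b) = \<sigma> powr (2 - real DIM('a) * (p - 1))"
    proof -
      have "2 / \<alpha> * (\<alpha> - 1 + 1 - b) = 2 - real DIM('a) * (p - 1)"
        using \<alpha>0 by (simp add: b_def field_simps)
      then show ?thesis by (simp only: t1_def powr_powr)
    qed
    finally have "m powr (p - 1) \<le> 16 / 15 * K * \<sigma> powr (- (2 - real DIM('a) * (p - 1)))"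
      using \<sigma> by (subst powr_minus_divide) (simp add: field_simps)
    then have "m \<le> (16 / 15 * K * \<sigma> powr (- (2 - real DIM('a) * (p - 1)))) powr (1 / (p - 1))"
      using p by (intro powr_le_imp_le_powr) (auto simp: m_def)
    also have "\<dots> = L * \<sigma> powr (- (2 - real DIM('a) * (p - 1)) * (1 / (p - 1)))"
      unfolding L_def using K by (subst powr_mult) (auto simp: powr_powr)
    also have "- (2 - real DIM('a) * (p - 1)) * (1 / (p - 1)) = real DIM('a) - 2 / (p - 1)"
      using p by (simp add: field_simps)
    finally show ?thesis by (simp add: m_def)
  qed
  ultimately show thesis using that by blast
qed

text \<open>At p = 1 + 2/N the exponent of s is exactly -\<alpha>. The interval now reaches up to T,
  and scaling by T turns the bound into an integral of t^(-\<alpha>) from t0/T to 1.\<close>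

lemma critical_bound:
  fixes a0 p :: real
  assumes a0: "0 < a0" and p: "p = 1 + 2 / real DIM('a::euclidean_space)"
  obtains K where "0 < K"
    "\<And>\<alpha> h T (\<mu> :: 'a measure) u z \<sigma>. a0 \<le> \<alpha> \<Longrightarrow> \<alpha> < 1 \<Longrightarrow> is_h_density \<alpha> h \<Longrightarrow>
      radon_measure \<mu> \<Longrightarrow> is_solution \<alpha> h p \<mu> (ereal T) u \<Longrightarrow> 0 < T \<Longrightarrow> 0 < \<sigma> \<Longrightarrow> \<sigma> powr (2 / \<alpha>) < T \<Longrightarrow>
      measure \<mu> (ball z \<sigma>) \<le> K *
        integral {\<sigma> powr (2 / \<alpha>) / (16 * T)..1 / 4} (\<lambda>t. t powr (- \<alpha>)) powr (- (real DIM('a) / 2))"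
proof -
  have p1: "1 < p" using p by simp
  obtain K where K: "0 < K" and bound: "\<And>\<alpha> h T (\<mu> :: 'a measure) u z \<sigma> t0 t1. a0 \<le> \<alpha> \<Longrightarrow> \<alpha> < 1 \<Longrightarrow>
      is_h_density \<alpha> h \<Longrightarrow> radon_measure \<mu> \<Longrightarrow> is_solution \<alpha> h p \<mu> (ereal T) u \<Longrightarrow> 0 < t0 \<Longrightarrow> t0 < t1 \<Longrightarrow> t1 \<le> T \<Longrightarrow>
      0 < \<sigma> \<Longrightarrow> \<sigma>\<^sup>2 \<le> 16 * t0 powr \<alpha> \<Longrightarrow>
      measure \<mu> (ball z \<sigma>) powr (p - 1) * (t1 powr (\<alpha> - 1) *
        integral {t0..t1} (\<lambda>s. s powr (- (\<alpha> * (real DIM('a) / 2) * (p - 1))))) \<le> K"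
    using solution_ball_bound [OF a0 p1, where 'a = 'a] by metis
  define L where "L = K powr (real DIM('a) / 2)"
  have "0 < L" using K by (simp add: L_def)
  moreover have "measure \<mu> (ball z \<sigma>) \<le> L *
      integral {\<sigma> powr (2 / \<alpha>) / (16 * T)..1 / 4} (\<lambda>t. t powr (- \<alpha>)) powr (- (real DIM('a) / 2))"
    if \<alpha>: "a0 \<le> \<alpha>" "\<alpha> < 1" and *: "is_h_density \<alpha> h" "radon_measure \<mu>" "is_solution \<alpha> h p \<mu> (ereal T) u"
      and T: "0 < T" and \<sigma>: "0 < \<sigma>" "\<sigma> powr (2 / \<alpha>) < T"
    for \<alpha> h T and \<mu> :: "'a measure" and u z \<sigma>
  proof -
    define t0 where "t0 = \<sigma> powr (2 / \<alpha>) / 16"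
    define m where "m = measure \<mu> (ball z \<sigma>)"
    define J where "J = integral {t0 / T..1 / 4} (\<lambda>t. t powr (- \<alpha>))"
    have \<alpha>0: "0 < \<alpha>" using \<alpha> a0 by simp
    have t0: "0 < t0" "16 * t0 < T" using \<sigma> by (simp_all add: t0_def)
    have sq: "\<sigma>\<^sup>2 \<le> 16 * t0 powr \<alpha>"
      unfolding t0_def using \<alpha> \<alpha>0 \<sigma> by (intro square_le_powr) auto
    have exponent: "\<alpha> * (real DIM('a) / 2) * (p - 1) = \<alpha>" using p by simp
    have "m powr (p - 1) * (T powr (\<alpha> - 1) * integral {t0..T} (\<lambda>s. s powr (- \<alpha>))) \<le> K"
      using bound [OF \<alpha> *, of t0 T \<sigma> z, unfolded exponent] sq t0 \<sigma> by (simp add: m_def)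
    moreover have "J \<le> T powr (\<alpha> - 1) * integral {t0..T} (\<lambda>s. s powr (- \<alpha>))"
    proof -
      have "J = ((1 / 4) powr (1 - \<alpha>) - (t0 / T) powr (1 - \<alpha>)) / (1 - \<alpha>)"
        unfolding J_def using t0 T \<alpha> by (intro integral_powr_minus) (auto simp: field_simps)
      \<comment> \<open>This enlarges the upper limit of integration from 1/4 to 1.\<close>
      also have "\<dots> \<le> (1 - (t0 / T) powr (1 - \<alpha>)) / (1 - \<alpha>)"
        using \<alpha> powr_mono2 [of "1 - \<alpha>" "1 / 4" 1] by (intro divide_right_mono) auto
      also have "\<dots> = T powr (\<alpha> - 1) * ((T powr (1 - \<alpha>) - t0 powr (1 - \<alpha>)) / (1 - \<alpha>))"
      proof -
        have "T powr (\<alpha> - 1) * T powr (1 - \<alpha>) = 1"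
          using T by (simp flip: powr_add)
        moreover have "(t0 / T) powr (1 - \<alpha>) = T powr (\<alpha> - 1) * t0 powr (1 - \<alpha>)"
          using T t0 powr_minus_divide [of T "1 - \<alpha>"] by (simp add: powr_divide)
        ultimately show ?thesis by (simp add: right_diff_distrib)
      qed
      also have "(T powr (1 - \<alpha>) - t0 powr (1 - \<alpha>)) / (1 - \<alpha>) = integral {t0..T} (\<lambda>s. s powr (- \<alpha>))"
        using t0 T \<alpha> by (intro integral_powr_minus [symmetric]) auto
      finally show ?thesis .
    qed
    ultimately have mJ: "m powr (p - 1) * J \<le> K"
      by (meson mult_left_mono order_trans powr_ge_zero)
    \<comment> \<open>From 16 t0 < T the lower limit t0/T is less than 1/16, hence below 1/4;
      positivity permits dividing by J.\<close>
    have J: "0 < J"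
    proof -
      have "(t0 / T) powr (1 - \<alpha>) < (1 / 4) powr (1 - \<alpha>)"
        using t0 T \<alpha> by (intro powr_less_mono2) (auto simp: field_simps)
      moreover have "J = ((1 / 4) powr (1 - \<alpha>) - (t0 / T) powr (1 - \<alpha>)) / (1 - \<alpha>)"
        unfolding J_def using t0 T \<alpha> by (intro integral_powr_minus) (auto simp: field_simps)
      ultimately show ?thesis using \<alpha> by simp
    qed
    have "m powr (p - 1) \<le> K / J" using mJ J by (simp add: field_simps)
    then have "m \<le> (K / J) powr (1 / (p - 1))"
      using p1 by (intro powr_le_imp_le_powr) (auto simp: m_def)
    also have "1 / (p - 1) = real DIM('a) / 2" using p by simp
    also have "(K / J) powr (real DIM('a) / 2) = L * J powr (- (real DIM('a) / 2))"
      unfolding L_def using K J by (simp add: powr_divide powr_minus_divide)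
    finally show ?thesis by (simp add: m_def J_def t0_def)
  qed
  ultimately show thesis using that by blast
qed

text \<open>Closed balls are compact and have finite mass, so the real-valued
  \<open>measure\<close>, which would read infinite mass as 0, agrees with \<open>emeasure\<close>
  on balls.\<close>

lemma SUP_emeasure_ball_le:
  fixes \<mu> :: "'a::euclidean_space measure"
  assumes radon: "radon_measure \<mu>" and le: "\<And>z. measure \<mu> (ball z \<sigma>) \<le> B"
  shows "(SUP z. emeasure \<mu> (ball z \<sigma>)) \<le> ennreal B"
proof (rule SUP_least)
  fix z :: 'a
  have "emeasure \<mu> (ball z \<sigma>) \<le> emeasure \<mu> (cball z \<sigma>)"
    using radon by (intro emeasure_mono) (auto simp: radon_measure_def)
  also have "\<dots> < \<infinity>" using radon by (auto simp: radon_measure_def)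
  finally have "emeasure \<mu> (ball z \<sigma>) = ennreal (measure \<mu> (ball z \<sigma>))"
    by (simp add: emeasure_eq_ennreal_measure less_top)
  then show "emeasure \<mu> (ball z \<sigma>) \<le> ennreal B" using le [of z] by (simp add: ennreal_leI)
qed

lemma powr_half_less_imp:
  fixes \<sigma> T \<alpha> :: real
  assumes "0 < \<alpha>" "0 < T" "0 < \<sigma>" "\<sigma> < T powr (\<alpha> / 2)"
  shows "\<sigma> powr (2 / \<alpha>) < T"
proof -
  have "\<sigma> powr (2 / \<alpha>) < (T powr (\<alpha> / 2)) powr (2 / \<alpha>)"
    using assms by (intro powr_less_mono2) auto
  also have "\<dots> = T" using assms by (simp add: powr_powr)
  finally show ?thesis .
qed

theorem theorem1p1:
  fixes p :: real
  assumes "1 < p"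
  shows
    "(\<exists>\<gamma> :: real \<Rightarrow> real.
        (\<forall>\<alpha>\<in>{0<..<1}. 0 < \<gamma> \<alpha>) \<and>
        0 < Limsup (at_left 1) (\<lambda>\<alpha>. ereal (\<gamma> \<alpha>)) \<and>
        Limsup (at_left 1) (\<lambda>\<alpha>. ereal (\<gamma> \<alpha>)) < \<infinity> \<and>
        (\<forall>\<alpha>\<in>{0<..<1}. \<forall>h. is_h_density \<alpha> h \<longrightarrow>
          (\<forall>T::real. 0 < T \<longrightarrow> (\<forall>\<mu> :: (real ^ 'n) measure. radon_measure \<mu> \<longrightarrow>
            (\<exists>u. is_solution \<alpha> h p \<mu> (ereal T) u) \<longrightarrow>
            (\<forall>\<sigma>\<in>{0<..<T powr (\<alpha> / 2)}.
              (SUP z. emeasure \<mu> (ball z \<sigma>)) \<le>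
                ennreal (\<gamma> \<alpha> * \<sigma> powr (real CARD('n) - 2 / (p - 1))))))))
     \<and>
     (p = 1 + 2 / real CARD('n) \<longrightarrow>
      (\<exists>\<gamma>' :: real \<Rightarrow> real.
        (\<forall>\<alpha>\<in>{0<..<1}. 0 < \<gamma>' \<alpha>) \<and>
        0 < Limsup (at_left 1) (\<lambda>\<alpha>. ereal (\<gamma>' \<alpha>)) \<and>
        Limsup (at_left 1) (\<lambda>\<alpha>. ereal (\<gamma>' \<alpha>)) < \<infinity> \<and>
        (\<forall>\<alpha>\<in>{0<..<1}. \<forall>h. is_h_density \<alpha> h \<longrightarrow>
          (\<forall>T::real. 0 < T \<longrightarrow> (\<forall>\<mu> :: (real ^ 'n) measure. radon_measure \<mu> \<longrightarrow>
            (\<exists>u. is_solution \<alpha> h p \<mu> (ereal T) u) \<longrightarrow>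
            (\<forall>\<sigma>\<in>{0<..<T powr (\<alpha> / 2)}.
              (SUP z. emeasure \<mu> (ball z \<sigma>)) \<le>
                ennreal (\<gamma>' \<alpha> *
                  (integral {\<sigma> powr (2 / \<alpha>) / (16 * T)..1 / 4} (\<lambda>t. t powr (- \<alpha>)))
                    powr (- (real CARD('n) / 2)))))))))"
proof (intro conjI impI)
  let ?Q = "\<lambda>\<alpha> K. \<forall>h. is_h_density \<alpha> h \<longrightarrow> (\<forall>T::real. 0 < T \<longrightarrow> (\<forall>\<mu> :: (real ^ 'n) measure.
    radon_measure \<mu> \<longrightarrow> (\<exists>u. is_solution \<alpha> h p \<mu> (ereal T) u) \<longrightarrow> (\<forall>\<sigma>\<in>{0<..<T powr (\<alpha> / 2)}.
      (SUP z. emeasure \<mu> (ball z \<sigma>)) \<le> ennreal (K * \<sigma> powr (real CARD('n) - 2 / (p - 1))))))"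
  \<comment> \<open>One constant for all orders in [a0, 1), uniform in h, T and \<mu>, is the form
    that \<open>uniform_constant_choice\<close> turns into a function of \<alpha>. The condition on
    \<sigma> enters as \<sigma>^(2/\<alpha>) < T.\<close>
  have "\<exists>K>0. \<forall>\<alpha>. a0 \<le> \<alpha> \<and> \<alpha> < 1 \<longrightarrow> ?Q \<alpha> K" if a0: "0 < a0" for a0
  proof -
    obtain K where K: "0 < K" "\<And>\<alpha> h T (\<mu> :: (real ^ 'n) measure) u z \<sigma>. a0 \<le> \<alpha> \<Longrightarrow> \<alpha> < 1 \<Longrightarrow>
        is_h_density \<alpha> h \<Longrightarrow> radon_measure \<mu> \<Longrightarrow> is_solution \<alpha> h p \<mu> (ereal T) u \<Longrightarrow> 0 < \<sigma> \<Longrightarrow> \<sigma> powr (2 / \<alpha>) \<le> T \<Longrightarrow>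
        measure \<mu> (ball z \<sigma>) \<le> K * \<sigma> powr (real DIM(real ^ 'n) - 2 / (p - 1))"
      using parabolic_scale_bound [OF a0 assms, where 'a = "real ^ 'n"] by metis
    have "?Q \<alpha> K" if \<alpha>: "a0 \<le> \<alpha>" "\<alpha> < 1" for \<alpha>
      using K(2) [OF \<alpha>] a0 \<alpha> powr_half_less_imp [of \<alpha>]
      by (force intro!: SUP_emeasure_ball_le intro: less_imp_le)
    with K(1) show ?thesis by blast
  qed
  then show "\<exists>\<gamma>. (\<forall>\<alpha>\<in>{0<..<1}. 0 < \<gamma> \<alpha>) \<and> 0 < Limsup (at_left 1) (\<lambda>\<alpha>. ereal (\<gamma> \<alpha>)) \<and>
      Limsup (at_left 1) (\<lambda>\<alpha>. ereal (\<gamma> \<alpha>)) < \<infinity> \<and> (\<forall>\<alpha>\<in>{0<..<1}. ?Q \<alpha> (\<gamma> \<alpha>))"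
    by (rule uniform_constant_choice)
next
  assume p: "p = 1 + 2 / real CARD('n)"
  let ?Q = "\<lambda>\<alpha> K. \<forall>h. is_h_density \<alpha> h \<longrightarrow> (\<forall>T::real. 0 < T \<longrightarrow> (\<forall>\<mu> :: (real ^ 'n) measure.
    radon_measure \<mu> \<longrightarrow> (\<exists>u. is_solution \<alpha> h p \<mu> (ereal T) u) \<longrightarrow> (\<forall>\<sigma>\<in>{0<..<T powr (\<alpha> / 2)}.
      (SUP z. emeasure \<mu> (ball z \<sigma>)) \<le> ennreal (K *
        (integral {\<sigma> powr (2 / \<alpha>) / (16 * T)..1 / 4} (\<lambda>t. t powr (- \<alpha>))) powr (- (real CARD('n) / 2))))))"
  have "\<exists>K>0. \<forall>\<alpha>. a0 \<le> \<alpha> \<and> \<alpha> < 1 \<longrightarrow> ?Q \<alpha> K" if a0: "0 < a0" for a0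
  proof -
    have p': "p = 1 + 2 / real DIM(real ^ 'n)" using p by simp
    obtain K where K: "0 < K" "\<And>\<alpha> h T (\<mu> :: (real ^ 'n) measure) u z \<sigma>. a0 \<le> \<alpha> \<Longrightarrow> \<alpha> < 1 \<Longrightarrow>
        is_h_density \<alpha> h \<Longrightarrow> radon_measure \<mu> \<Longrightarrow> is_solution \<alpha> h p \<mu> (ereal T) u \<Longrightarrow> 0 < T \<Longrightarrow> 0 < \<sigma> \<Longrightarrow>
        \<sigma> powr (2 / \<alpha>) < T \<Longrightarrow> measure \<mu> (ball z \<sigma>) \<le> K *
        integral {\<sigma> powr (2 / \<alpha>) / (16 * T)..1 / 4} (\<lambda>t. t powr (- \<alpha>)) powr (- (real DIM(real ^ 'n) / 2))"
      using critical_bound [OF a0 p'] by metis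
    have "?Q \<alpha> K" if \<alpha>: "a0 \<le> \<alpha>" "\<alpha> < 1" for \<alpha>
      using K(2) [OF \<alpha>] a0 \<alpha> powr_half_less_imp [of \<alpha>]
      by (force intro!: SUP_emeasure_ball_le)
    with K(1) show ?thesis by blast
  qed
  then show "\<exists>\<gamma>'. (\<forall>\<alpha>\<in>{0<..<1}. 0 < \<gamma>' \<alpha>) \<and> 0 < Limsup (at_left 1) (\<lambda>\<alpha>. ereal (\<gamma>' \<alpha>)) \<and>
      Limsup (at_left 1) (\<lambda>\<alpha>. ereal (\<gamma>' \<alpha>)) < \<infinity> \<and> (\<forall>\<alpha>\<in>{0<..<1}. ?Q \<alpha> (\<gamma>' \<alpha>))"
    by (rule uniform_constant_choice)
qed

end
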